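(* Let $C_n$ be the classifier built with bandwidth $h\in(0,\infty)$ and privacy parameter $\alpha>0$ from the privatised data $Z_1,\ldots,Z_{2n}$ as described in the context. Suppose that $h\to0$ and $n\alpha^2h^{2d}\to\infty$ as $n\to\infty$. Then, for any probability distribution $P$ on $\mathbb{R}^d\times\{0,1\}$, we have $\mathcal{E}_P(C_n)\to0$ as $n\to\infty$.
   Context: Let $(X,Y),(X_1,Y_1),\ldots,(X_{2n},Y_{2n})$ be i.i.d. with distribution $P$ on $\mathbb{R}^d\times\{0,1\}$. Privatised data. Given $h,\alpha>0$, for $j=(j_1,\ldots,j_d)\in\mathbb{Z}^d$ set $x_j:=(j_1h,\ldots,j_dh)$ and for $x\in\mathbb{R}^d$ let $j^*(x):=\mathrm{argmin}_{j\in\mathbb{Z}^d}\|x-x_j\|$ ($\|\cdot\|$ is the Euclidean norm). For $i=1,\ldots,2n$ let $B_i:=(\mathbf{1}_{\{\|X_i-x_j\|_\infty<h\}})_{j\in\mathbb{Z}^d}$, and let $\epsilon_i=(\epsilon_{ij})_{j\in\mathbb{Z}^d}$ be a random array with i.i.d. $\mathrm{Laplace}(\alpha/2^{d+1})$ entries, generated independently for each $i$ and independently of $(X,Y)$ and of the data, where $\mathrm{Laplace}(b)$ has density $z\mapsto\frac b2e^{-b|z|}$. Set $Z_i=B_i+\epsilon_i$ for $1\le i\le n$ and $Z_i=Y_iB_i+\epsilon_i$ for $n+1\le i\le 2n$; write $Z_{ij}$ for the $j$th entry of $Z_i$. Classifier. For a test point $x_0$, $$T_n(x_0):=\frac1n\sum_{i=n+1}^{2n}Z_{i\,j^*(x_0)}-\frac1{2n}\sum_{i=1}^nZ_{i\,j^*(x_0)},\qquad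 C_n(x_0):=\mathbf{1}_{\{T_n(x_0)\ge0\}}.$$ Excess risk. Let $\eta(x):=\mathbb{P}(Y=1\mid X=x)$, $C^{\mathrm B}(x):=\mathbf{1}_{\{\eta(x)\ge1/2\}}$ (Bayes classifier), $R_P(C):=\mathbb{P}(C(X)\ne Y)$, the probability being over $(X,Y)$ and, for a data-dependent classifier, also over the data and the privacy noise. Then $$\mathcal{E}_P(C_n):=R_P(C_n)-R_P(C^{\mathrm B})=\mathbb{E}\bigl[\{\mathbb{P}(C_n(X)=0\mid X)-\mathbf{1}_{\{\eta(X)<1/2\}}\}\{2\eta(X)-1\}\bigr].$$ *)

theory Defs
  imports "HOL-Probability.Probability"
begin

text \<open>
  Observations are pairs \<open>(x, y)\<close> with \<open>x\<close> in \<open>real ^ 'd\<close> and \<open>y\<close> in \<open>{0, 1}\<close>; the dimension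
  \<open>d\<close> is \<open>CARD('d)\<close>, and grid indices are vectors in \<open>int ^ 'd\<close>.
\<close>

definition labelled_space :: "((real ^ 'd::finite) \<times> nat) measure" where
  "labelled_space = borel \<Otimes>\<^sub>M count_space {0, 1}"

definition labelled_distribution :: "((real ^ 'd::finite) \<times> nat) measure \<Rightarrow> bool" where
  "labelled_distribution P \<longleftrightarrow> prob_space P \<and> sets P = sets labelled_space"

definition laplace_density :: "real \<Rightarrow> real \<Rightarrow> real" where
  "laplace_density b z = b / 2 * exp (- b * \<bar>z\<bar>)"

definition grid_point :: "real \<Rightarrow> int ^ 'd \<Rightarrow> real ^ 'd::finite" where
  "grid_point h j = (\<chi> k. of_int (j $ k) * h)"

text \<open>
  Ties in the argmin are resolved by the choice operator. As \<open>arg_min\<close> depends on \<open>x\<close> only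
  through the set of minimisers, which is one of countably many finite sets, \<open>nearest_index h\<close>
  is Borel measurable for \<open>h > 0\<close>.
\<close>

definition nearest_index :: "real \<Rightarrow> real ^ 'd::finite \<Rightarrow> int ^ 'd" where
  "nearest_index h x = (ARG_MIN (\<lambda>j. norm (x - grid_point h j)) j. True)"

definition box_indicator :: "real \<Rightarrow> real ^ 'd::finite \<Rightarrow> int ^ 'd \<Rightarrow> real" where
  "box_indicator h x j = of_bool (infnorm (x - grid_point h j) < h)"

text \<open>
  The family \<open>S\<close> collects the test pair and the data: \<open>S 0\<close> is \<open>(X, Y)\<close> and \<open>S i\<close> is
  \<open>(X\<^sub>i, Y\<^sub>i)\<close> for \<open>1 \<le> i \<le> 2n\<close>. The pairs and the noise variables take values in
  different types, so their joint mutual independence is stated for the generated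
  sigma-algebras, indexed by a disjoint sum.
\<close>

definition privacy_model ::
  "((real ^ 'd::finite) \<times> nat) measure \<Rightarrow> nat \<Rightarrow> real \<Rightarrow> 'w measure \<Rightarrow>
    (nat \<Rightarrow> 'w \<Rightarrow> (real ^ 'd) \<times> nat) \<Rightarrow> (nat \<Rightarrow> int ^ 'd \<Rightarrow> 'w \<Rightarrow> real) \<Rightarrow> bool" where
  "privacy_model P n \<alpha> M S \<epsilon> \<longleftrightarrow>
     prob_space M \<and>
     (\<forall>i\<in>{0..2*n}. S i \<in> M \<rightarrow>\<^sub>M P \<and> distr M P (S i) = P) \<and>
     (\<forall>i\<in>{1..2*n}. \<forall>j. distributed M lborel (\<epsilon> i j) (laplace_density (\<alpha> / 2 ^ (CARD('d) + 1)))) \<and>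
     prob_space.indep_sets M
       (case_sum
         (\<lambda>i. {S i -` A \<inter> space M | A. A \<in> sets P})
         (\<lambda>(i, j). {\<epsilon> i j -` A \<inter> space M | A. A \<in> sets borel}))
       ({0..2*n} <+> ({1..2*n} \<times> UNIV))"

definition privatised ::
  "nat \<Rightarrow> real \<Rightarrow> (nat \<Rightarrow> 'w \<Rightarrow> (real ^ 'd::finite) \<times> nat) \<Rightarrow> (nat \<Rightarrow> int ^ 'd \<Rightarrow> 'w \<Rightarrow> real) \<Rightarrow>
    'w \<Rightarrow> nat \<Rightarrow> int ^ 'd \<Rightarrow> real" where
  "privatised n h S \<epsilon> \<omega> i j =
     (if i \<le> n then box_indicator h (fst (S i \<omega>)) j + \<epsilon> i j \<omega>
      else real (snd (S i \<omega>)) * box_indicator h (fst (S i \<omega>)) j + \<epsilon> i j \<omega>)"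

definition test_stat :: "nat \<Rightarrow> real \<Rightarrow> (nat \<Rightarrow> int ^ 'd::finite \<Rightarrow> real) \<Rightarrow> real ^ 'd \<Rightarrow> real" where
  "test_stat n h Z x\<^sub>0 =
     1 / real n * (\<Sum>i=n+1..2*n. Z i (nearest_index h x\<^sub>0))
     - 1 / (2 * real n) * (\<Sum>i=1..n. Z i (nearest_index h x\<^sub>0))"

definition private_classifier ::
  "nat \<Rightarrow> real \<Rightarrow> (nat \<Rightarrow> int ^ 'd::finite \<Rightarrow> real) \<Rightarrow> real ^ 'd \<Rightarrow> nat" where
  "private_classifier n h Z x\<^sub>0 = of_bool (test_stat n h Z x\<^sub>0 \<ge> 0)"

text \<open>
  \<open>\<eta>\<close> is a version of \<open>x \<mapsto> \<P>(Y = 1 | X = x)\<close>: composed with the first coordinate it is the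
  conditional expectation of the label indicator given the sigma-algebra generated by that
  coordinate.
\<close>

definition regression_function ::
  "((real ^ 'd::finite) \<times> nat) measure \<Rightarrow> (real ^ 'd \<Rightarrow> real) \<Rightarrow> bool" where
  "regression_function P \<eta> \<longleftrightarrow>
     \<eta> \<in> borel_measurable borel \<and>
     (AE z in P. \<eta> (fst z) =
        real_cond_exp P (vimage_algebra (space P) fst borel) (\<lambda>z. of_bool (snd z = 1)) z)"

definition bayes_classifier :: "(real ^ 'd::finite \<Rightarrow> real) \<Rightarrow> real ^ 'd \<Rightarrow> nat" where
  "bayes_classifier \<eta> x = of_bool (\<eta> x \<ge> 1 / 2)"

text \<open>
  A data-dependent classifier is a function \<open>C\<close> of the outcome and the test point, so the risk
  averages over the test pair, the data and the privacy noise.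
\<close>

definition risk ::
  "'w measure \<Rightarrow> ('w \<Rightarrow> (real ^ 'd::finite) \<times> nat) \<Rightarrow> ('w \<Rightarrow> real ^ 'd \<Rightarrow> nat) \<Rightarrow> real" where
  "risk M XY C = \<P>(\<omega> in M. C \<omega> (fst (XY \<omega>)) \<noteq> snd (XY \<omega>))"

definition excess_risk ::
  "'w measure \<Rightarrow> ('w \<Rightarrow> (real ^ 'd::finite) \<times> nat) \<Rightarrow> (real ^ 'd \<Rightarrow> real) \<Rightarrow>
    ('w \<Rightarrow> real ^ 'd \<Rightarrow> nat) \<Rightarrow> real" where
  "excess_risk M XY \<eta> C = risk M XY C - risk M XY (\<lambda>_. bayes_classifier \<eta>)"

end

theory Submission
  imports Defs
begin

text \<open>
  Write \<open>\<mu>\<close> for the law of \<open>X\<close>, \<open>f = 2 * \<eta> - 1\<close>, \<open>A\<^sub>j\<close> for the open sup-norm ball of radius \<open>h\<close>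
  around the grid point \<open>j\<close> (\<open>grid_box\<close>), and \<open>C\<^sub>j \<subseteq> A\<^sub>j\<close> for the set of points whose nearest grid
  point is \<open>j\<close> (\<open>grid_cell\<close>).  On \<open>C\<^sub>j\<close> the classifier looks at one random number \<open>T\<^sub>j\<close>
  (\<open>box_stat\<close>), whose mean is \<open>\<integral>\<^bsub>A\<^sub>j\<^esub> f d\<mu> / 2 = a\<^sub>j * \<mu>(A\<^sub>j) / 2\<close> with \<open>a\<^sub>j\<close> the average of \<open>f\<close> over
  \<open>A\<^sub>j\<close>.  The Bayes classifier looks at the sign of \<open>f(x)\<close> instead, so there are two sources of
  error, statistical and geometric, and nothing about \<open>P\<close> may be assumed in bounding them.

  Statistical error.  All signals are bounded by \<open>1\<close> and the Laplace variables have variance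
  \<open>2 / b\<^sup>2\<close> with \<open>b = \<alpha> / 2 ^ (d + 1)\<close>, so by independence the variance of \<open>T\<^sub>j\<close> is of order
  \<open>(1 + 1 / \<alpha>\<^sup>2) / n\<close>.  If \<open>T\<^sub>j\<close> and its mean have different signs, then \<open>T\<^sub>j\<close> misses the mean by at
  least the modulus of the mean; hence the probability of a wrong sign, multiplied by \<open>\<bar>a\<^sub>j\<bar>\<close>, is at
  most \<open>2 * sd(T\<^sub>j) / \<mu>(A\<^sub>j)\<close>.  Here the factor \<open>\<bar>a\<^sub>j\<bar>\<close> comes for free because excess risk is weighted
  with \<open>\<bar>f\<bar>\<close>.  This is small as soon as \<open>\<mu>(A\<^sub>j) \<ge> t * h ^ d\<close> for a fixed \<open>t > 0\<close>, because then
  \<open>var(T\<^sub>j) / \<mu>(A\<^sub>j)\<^sup>2\<close> is of order \<open>(\<alpha>\<^sup>2 + 1) / (n * \<alpha>\<^sup>2 * h ^ (2 * d))\<close>, and \<open>\<alpha>\<close> is bounded.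
  Boxes violating this bound carry little mass in total: a bounded region, outside which \<open>\<mu>\<close> has
  small mass, meets only \<open>O(h ^ (- d))\<close> of them (\<open>light_boxes_negligible\<close>).

  Geometric error.  It remains to see that replacing \<open>f(x)\<close> by \<open>a\<^sub>j\<close> on each \<open>C\<^sub>j\<close> costs little in
  \<open>L\<^sup>1(\<mu>)\<close>.  For uniformly continuous \<open>f\<close> this is immediate, these functions are dense in \<open>L\<^sup>1(\<mu>)\<close>
  (\<open>uniformly_continuous_dense_L1\<close>), and the passage from \<open>f\<close> to its box averages is bounded on
  \<open>L\<^sup>1(\<mu>)\<close> because \<open>\<mu>(C\<^sub>j) \<le> \<mu>(A\<^sub>j)\<close> and every point lies in a bounded number of boxes
  (\<open>box_average_converges_L1\<close>).

  Both errors are collected in \<open>excess_risk_bound\<close>, a bound for fixed \<open>n\<close>.  Only finitely many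
  cells enter it, the others being charged with their total mass, which keeps all sums finite.
\<close>

section \<open>Grid boxes and nearest grid points\<close>

definition grid_box :: "real \<Rightarrow> int ^ 'd \<Rightarrow> (real ^ 'd::finite) set" where
  "grid_box h j = {x. infnorm (x - grid_point h j) < h}"

definition grid_cell :: "real \<Rightarrow> int ^ 'd \<Rightarrow> (real ^ 'd::finite) set" where
  "grid_cell h j = {x. nearest_index h x = j}"

lemma box_indicator_eq: "box_indicator h x j = indicator (grid_box h j) x"
  by (simp add: box_indicator_def grid_box_def indicator_def)

lemma mem_grid_box:
  "x \<in> grid_box h j \<longleftrightarrow> (\<forall>k. \<bar>x $ k - of_int (j $ k) * h\<bar> < h)"
proof
  assume "x \<in> grid_box h j"
  then show "\<forall>k. \<bar>x $ k - of_int (j $ k) * h\<bar> < h"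
    using component_le_infnorm_cart[of "x - grid_point h j"]
    by (auto simp: grid_box_def grid_point_def intro: le_less_trans)
next
  assume *: "\<forall>k. \<bar>x $ k - of_int (j $ k) * h\<bar> < h"
  let ?S = "{\<bar>(x - grid_point h j) $ k\<bar> |k. k \<in> UNIV}"
  have "?S = range (\<lambda>k. \<bar>(x - grid_point h j) $ k\<bar>)" by auto
  then have fin: "finite ?S" "?S \<noteq> {}" by auto
  then have "Sup ?S = Max ?S" by (rule cSup_eq_Max)
  also have "\<dots> < h"
    using fin * by (subst Max_less_iff) (auto simp: grid_point_def)
  finally show "x \<in> grid_box h j"
    by (simp add: grid_box_def infnorm_cart)
qed

lemma grid_box_measurable [measurable]: "grid_box h j \<in> sets borel"
proof -
  have "open (grid_box h j)"
    unfolding grid_box_def by (intro open_Collect_less continuous_intros)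
  then show ?thesis by simp
qed

text \<open>
  Squared Euclidean distance is a sum over the coordinates, and rounding each coordinate minimises every
  summand simultaneously.  A minimiser of the sum must therefore minimise each summand.
\<close>

lemma norm_minimiser_componentwise:
  fixes x :: "real ^ 'd::finite"
  assumes h: "h > 0" and min: "\<And>i. norm (x - grid_point h j) \<le> norm (x - grid_point h i)"
  shows "\<bar>x $ k - of_int (j $ k) * h\<bar> \<le> h / 2"
proof -
  define r :: "int ^ 'd" where "r = (\<chi> k. round (x $ k / h))"
  have scale: "\<bar>x $ k - of_int m * h\<bar> = h * \<bar>x $ k / h - of_int m\<bar>" for k and m :: int
    using h by (simp add: abs_mult_pos' right_diff_distrib mult.commute)
  have best: "(x $ k - of_int (r $ k) * h)\<^sup>2 \<le> (x $ k - of_int (j $ k) * h)\<^sup>2" for k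
    using h round_diff_minimal[of "x $ k / h" "j $ k"]
    by (subst abs_le_square_iff[symmetric]) (simp add: scale r_def)
  have half: "\<bar>x $ k - of_int (r $ k) * h\<bar> \<le> h / 2"
    using h of_int_round_abs_le[of "x $ k / h"]
    by (simp add: scale r_def abs_minus_commute)
  have "(norm (x - grid_point h j))\<^sup>2 \<le> (norm (x - grid_point h r))\<^sup>2"
    using min by (intro power_mono) auto
  then have "(\<Sum>k\<in>UNIV. (x $ k - of_int (j $ k) * h)\<^sup>2) \<le> (\<Sum>k\<in>UNIV. (x $ k - of_int (r $ k) * h)\<^sup>2)"
    by (simp add: norm_vec_def L2_set_def grid_point_def sum_nonneg)
  then have "\<not> (x $ k - of_int (r $ k) * h)\<^sup>2 < (x $ k - of_int (j $ k) * h)\<^sup>2"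
    using best sum_strict_mono_ex1[of UNIV "\<lambda>k. (x $ k - of_int (r $ k) * h)\<^sup>2" "\<lambda>k. (x $ k - of_int (j $ k) * h)\<^sup>2"]
    by (auto simp: not_less[symmetric])
  then have "\<bar>x $ k - of_int (j $ k) * h\<bar> \<le> \<bar>x $ k - of_int (r $ k) * h\<bar>"
    by (simp add: abs_le_square_iff)
  with half show ?thesis by simp
qed

lemma finite_index_box:
  fixes lo hi :: "'d::finite \<Rightarrow> int"
  shows "finite {j :: int ^ 'd. \<forall>k. lo k \<le> j $ k \<and> j $ k \<le> hi k}"
    and "card {j :: int ^ 'd. \<forall>k. lo k \<le> j $ k \<and> j $ k \<le> hi k} = (\<Prod>k\<in>UNIV. nat (hi k + 1 - lo k))"
proof -
  let ?I = "{j :: int ^ 'd. \<forall>k. lo k \<le> j $ k \<and> j $ k \<le> hi k}"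
  let ?F = "PiE UNIV (\<lambda>k. {lo k..hi k})"
  have bij: "bij_betw vec_nth ?I ?F"
    by (rule bij_betw_byWitness[of _ vec_lambda]) (auto simp: PiE_iff)
  moreover have "finite ?F" by (intro finite_PiE) auto
  ultimately show "finite ?I" using bij_betw_finite by blast
  show "card ?I = (\<Prod>k\<in>UNIV. nat (hi k + 1 - lo k))"
    using bij_betw_same_card[OF bij] by (simp add: card_PiE algebra_simps)
qed

text \<open>
  Each coordinate of \<open>j\<close> ranges over the integers of an interval of length \<open>2 * c / h\<close>.  The count
  serves both for the overlap of the boxes and for the number of boxes near the origin.
\<close>

lemma finite_near_indices:
  fixes x :: "real ^ 'd::finite"
  assumes h: "h > 0"
  shows "finite {j :: int ^ 'd. \<forall>k. \<bar>x $ k - of_int (j $ k) * h\<bar> \<le> c}"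
    and "real (card {j :: int ^ 'd. \<forall>k. \<bar>x $ k - of_int (j $ k) * h\<bar> \<le> c}) \<le> (2 * \<bar>c\<bar> / h + 1) ^ CARD('d)"
proof -
  let ?lo = "\<lambda>k. \<lceil>(x $ k - c) / h\<rceil>" and ?hi = "\<lambda>k. \<lfloor>(x $ k + c) / h\<rfloor>"
  have eq: "{j :: int ^ 'd. \<forall>k. \<bar>x $ k - of_int (j $ k) * h\<bar> \<le> c}
      = {j. \<forall>k. ?lo k \<le> j $ k \<and> j $ k \<le> ?hi k}"
    using h by (auto simp: ceiling_le_iff le_floor_iff divide_le_eq le_divide_eq abs_le_iff) (smt (verit))+
  show "finite {j :: int ^ 'd. \<forall>k. \<bar>x $ k - of_int (j $ k) * h\<bar> \<le> c}"
    unfolding eq by (rule finite_index_box)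
  have "real (nat (?hi k + 1 - ?lo k)) \<le> 2 * \<bar>c\<bar> / h + 1" for k
  proof -
    have "of_int (?hi k) \<le> (x $ k + c) / h" by simp
    moreover have "(x $ k - c) / h \<le> of_int (?lo k)" by simp
    ultimately have "real_of_int (?hi k) - of_int (?lo k) \<le> (x $ k + c) / h - (x $ k - c) / h" by linarith
    also have "\<dots> = 2 * c / h" by (simp add: diff_divide_distrib[symmetric])
    also have "\<dots> \<le> 2 * \<bar>c\<bar> / h" using h by (intro divide_right_mono) auto
    finally have 1: "real_of_int (?hi k) - of_int (?lo k) \<le> 2 * \<bar>c\<bar> / h" .
    have 2: "0 \<le> 2 * \<bar>c\<bar> / h" using h by simp
    show ?thesis using 1 2 by (cases "?hi k + 1 - ?lo k \<ge> 0") (auto simp: of_nat_nat)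
  qed
  then have "real (\<Prod>k\<in>UNIV. nat (?hi k + 1 - ?lo k)) \<le> (\<Prod>k\<in>(UNIV::'d set). 2 * \<bar>c\<bar> / h + 1)"
    unfolding of_nat_prod by (intro prod_mono) auto
  then show "real (card {j :: int ^ 'd. \<forall>k. \<bar>x $ k - of_int (j $ k) * h\<bar> \<le> c}) \<le> (2 * \<bar>c\<bar> / h + 1) ^ CARD('d)"
    unfolding eq finite_index_box(2) by simp
qed

lemma grid_box_overlap:
  fixes x :: "real ^ 'd::finite"
  assumes h: "h > 0" and J: "finite J"
  shows "(\<Sum>j\<in>J. indicator (grid_box h j) x :: real) \<le> 3 ^ CARD('d)"
proof -
  let ?N = "{j :: int ^ 'd. \<forall>k. \<bar>x $ k - of_int (j $ k) * h\<bar> \<le> h}"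
  have "(\<Sum>j\<in>J. indicator (grid_box h j) x :: real) = real (card {j \<in> J. x \<in> grid_box h j})"
    using J by (simp add: indicator_def sum.If_cases Int_def)
  also have "\<dots> \<le> real (card ?N)"
    using finite_near_indices(1)[OF h, of x h]
    by (intro of_nat_mono card_mono) (auto simp: mem_grid_box less_imp_le)
  also have "\<dots> \<le> 3 ^ CARD('d)"
    using finite_near_indices(2)[OF h, of x h] h by simp
  finally show ?thesis .
qed

lemma is_arg_min_grid_iff:
  "is_arg_min (\<lambda>j. norm (x - grid_point h j)) (\<lambda>_. True) j \<longleftrightarrow>
    (\<forall>i. norm (x - grid_point h j) \<le> norm (x - grid_point h i))"
  by (simp add: is_arg_min_linorder)

text \<open>
  The minimum over the infinite grid is attained because only finitely many grid points are
  as close to \<open>x\<close> as a given one.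
\<close>

lemma nearest_index_minimal:
  fixes x :: "real ^ 'd::finite"
  assumes h: "h > 0"
  shows "norm (x - grid_point h (nearest_index h x)) \<le> norm (x - grid_point h i)"
proof -
  define c where "c = norm (x - grid_point h i)"
  define N where "N = {j :: int ^ 'd. norm (x - grid_point h j) \<le> c}"
  have sub: "N \<subseteq> {j. \<forall>k. \<bar>x $ k - of_int (j $ k) * h\<bar> \<le> c}"
  proof safe
    fix j k assume "j \<in> N"
    then show "\<bar>x $ k - of_int (j $ k) * h\<bar> \<le> c"
      using component_le_norm_cart[of "x - grid_point h j" k] by (simp add: N_def grid_point_def)
  qed
  then have "finite N" using finite_near_indices(1)[OF h] finite_subset by blast
  moreover have "i \<in> N" by (simp add: N_def c_def)
  ultimately obtain j where j: "j \<in> N" "\<And>m. m \<in> N \<Longrightarrow> norm (x - grid_point h j) \<le> norm (x - grid_point h m)"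
    using arg_min_if_finite[of N "\<lambda>j. norm (x - grid_point h j)"]
    by (metis empty_iff linorder_not_less)
  have "norm (x - grid_point h j) \<le> norm (x - grid_point h m)" for m
    using j by (cases "m \<in> N") (auto simp: N_def)
  then have "is_arg_min (\<lambda>j. norm (x - grid_point h j)) (\<lambda>_. True) j"
    by (simp add: is_arg_min_grid_iff)
  then have "is_arg_min (\<lambda>j. norm (x - grid_point h j)) (\<lambda>_. True) (nearest_index h x)"
    unfolding nearest_index_def arg_min_def by (rule someI)
  then show ?thesis by (simp add: is_arg_min_grid_iff)
qed

lemma grid_cell_subset_grid_box:
  assumes "h > 0" shows "grid_cell h j \<subseteq> grid_box h j"
proof
  fix x assume "x \<in> grid_cell h j"
  then have "\<bar>x $ k - of_int (j $ k) * h\<bar> \<le> h / 2" for k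
    using norm_minimiser_componentwise[OF assms nearest_index_minimal[OF assms]]
    by (auto simp: grid_cell_def)
  moreover have "h / 2 < h" using assms by simp
  ultimately show "x \<in> grid_box h j"
    unfolding mem_grid_box by (blast intro: le_less_trans)
qed

text \<open>
  The choice among minimisers is arbitrary, but it is a function of the set of minimisers alone.  That
  set is finite, so as a function of \<open>x\<close> it takes countably many values, each on a Borel set.
\<close>

lemma nearest_index_measurable [measurable]:
  fixes h :: real
  assumes h: "h > 0"
  shows "(nearest_index h :: real ^ 'd \<Rightarrow> int ^ 'd::finite) \<in> borel \<rightarrow>\<^sub>M count_space UNIV"
proof -
  define A where "A j = {x :: real ^ 'd. \<forall>i. norm (x - grid_point h j) \<le> norm (x - grid_point h i)}" for j
  define m where "m x = {j. x \<in> A j}" for x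
  have A [measurable]: "A j \<in> sets borel" for j
  proof -
    have "A j = (\<Inter>i. {x. norm (x - grid_point h j) \<le> norm (x - grid_point h i)})"
      by (auto simp: A_def)
    also have "closed \<dots>" by (intro closed_INT ballI closed_Collect_le continuous_intros)
    finally show ?thesis by simp
  qed
  have "finite (m x)" for x
  proof (rule finite_subset)
    show "m x \<subseteq> {j. \<forall>k. \<bar>x $ k - of_int (j $ k) * h\<bar> \<le> h / 2}"
      using norm_minimiser_componentwise[OF h, of x] by (auto simp: m_def A_def)
  qed (rule finite_near_indices(1)[OF h])
  then have range: "range m \<subseteq> Collect finite" by auto
  have "m \<in> borel \<rightarrow>\<^sub>M count_space (Collect finite)"
  proof (subst measurable_count_space_eq_countable)
    show "countable (Collect finite :: (int ^ 'd) set set)" by (rule countable_Collect_finite)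
    show "m \<in> space borel \<rightarrow> Collect finite \<and> (\<forall>a\<in>Collect finite. m -` {a} \<inter> space borel \<in> sets borel)"
    proof (intro conjI ballI)
      fix F :: "(int ^ 'd) set"
      have "m -` {F} \<inter> space borel = (\<Inter>j. if j \<in> F then A j else - A j)"
      proof (intro set_eqI)
        fix x
        have "x \<in> (\<Inter>j. if j \<in> F then A j else - A j) \<longleftrightarrow> (\<forall>j. j \<in> F \<longleftrightarrow> x \<in> A j)" by auto
        also have "\<dots> \<longleftrightarrow> m x = F" by (auto simp: m_def)
        finally show "x \<in> m -` {F} \<inter> space borel \<longleftrightarrow> x \<in> (\<Inter>j. if j \<in> F then A j else - A j)"
          by simp
      qed
      also have "\<dots> \<in> sets borel"
        by (rule sets.countable_INT') (auto simp del: Int_iff)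
      finally show "m -` {F} \<inter> space borel \<in> sets borel" .
    qed (use range in auto)
  qed
  moreover have "nearest_index h = (\<lambda>F. SOME j. j \<in> F) \<circ> m"
    by (auto simp: fun_eq_iff nearest_index_def arg_min_def is_arg_min_grid_iff m_def A_def)
  ultimately show ?thesis
    using measurable_comp[of m borel "count_space (Collect finite)" "\<lambda>F. SOME j. j \<in> F" "count_space UNIV"]
    by simp
qed

lemma grid_cell_measurable [measurable]:
  assumes "h > 0" shows "grid_cell h j \<in> sets borel"
  using measurable_sets[OF nearest_index_measurable[OF assms], of "{j}"]
  by (simp add: grid_cell_def vimage_def)

section \<open>Box averages in \<open>L\<^sup>1\<close>\<close>

text \<open>
  For an indicator, take a compact inner approximation \<open>K\<close> and the Lipschitz functions
  \<open>max 0 (1 - k * infdist x K)\<close>, which decrease to the indicator of \<open>K\<close> as \<open>k\<close> grows.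
\<close>

lemma uniformly_continuous_dense_L1:
  fixes f :: "'a::polish_space \<Rightarrow> real"
  assumes fin: "finite_measure M" and sets_M: "sets M = sets borel" and f: "integrable M f" and e: "e > 0"
  shows "\<exists>g. uniformly_continuous_on UNIV g \<and> integrable M g \<and> (\<integral>x. \<bar>f x - g x\<bar> \<partial>M) < e"
  using f e
proof (induction arbitrary: e rule: integrable_induct)
  interpret finite_measure M by (rule fin)
  have [measurable_cong]: "sets M = sets borel" by (rule sets_M)
  {
    case (base A c)
    then have [measurable]: "A \<in> sets M" by simp
    \<comment> \<open>The summand \<open>1\<close> covers \<open>c = 0\<close>.\<close>
    define e' where "e' = e / (2 * (\<bar>c\<bar> + 1))"
    have e': "e' > 0" using \<open>e > 0\<close> by (simp add: e'_def)
    have ce': "\<bar>c\<bar> * e' \<le> e / 2"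
      using \<open>e > 0\<close> by (simp add: e'_def field_simps)
    have "\<exists>K. compact K \<and> K \<subseteq> A \<and> measure M A - e' < measure M K"
    proof (cases "measure M A - e' < 0")
      case True
      then show ?thesis by (intro exI[of _ "{}"]) auto
    next
      case False
      have "ennreal (measure M A - e') < ennreal (measure M A)"
        using False e' by (subst ennreal_less_iff) auto
      also have "\<dots> = (SUP K \<in> {K. K \<subseteq> A \<and> compact K}. emeasure M K)"
        by (subst inner_regular[OF sets_M, symmetric])
           (use base sets_M in \<open>auto simp: emeasure_eq_measure\<close>)
      finally obtain K where "K \<subseteq> A" "compact K" "ennreal (measure M A - e') < emeasure M K"
        by (auto simp: less_SUP_iff)
      then show ?thesis
        using False by (auto simp: emeasure_eq_measure ennreal_less_iff intro!: exI[of _ K])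
    qed
    then obtain K where K: "compact K" "K \<subseteq> A" "measure M A - e' < measure M K" by blast
    have [measurable]: "K \<in> sets M" using K(1) by (simp add: sets_M borel_compact)
    have AK: "(\<integral>x. \<bar>indicator A x * c - indicator K x * c\<bar> \<partial>M) = \<bar>c\<bar> * measure M (A - K)"
    proof -
      have "(\<integral>x. \<bar>indicator A x * c - indicator K x * c\<bar> \<partial>M) = (\<integral>x. \<bar>c\<bar> * indicator (A - K) x \<partial>M)"
        using K(2) by (intro Bochner_Integration.integral_cong) (auto simp: indicator_def)
      then show ?thesis by simp
    qed
    have "measure M (A - K) < e'" using K by (simp add: finite_measure_Diff)
    then have AK': "(\<integral>x. \<bar>indicator A x * c - indicator K x * c\<bar> \<partial>M) \<le> e / 2"
      unfolding AK using ce' mult_left_mono[of "measure M (A - K)" e' "\<bar>c\<bar>"] by linarith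
    have "\<exists>g. uniformly_continuous_on UNIV g \<and> integrable M g \<and>
        (\<integral>x. \<bar>indicator K x * c - g x\<bar> \<partial>M) < e / 2"
    \<comment> \<open>The distance to the empty set is \<open>0\<close> by convention, so this case needs its own approximant.\<close>
    proof (cases "K = {}")
      case True
      then show ?thesis using \<open>e > 0\<close>
        by (intro exI[of _ "\<lambda>_. 0"]) (auto intro: uniformly_continuous_on_const)
    next
      case False
      define g where "g k x = c * max 0 (1 - real k * infdist x K)" for k :: nat and x
      have g_le: "\<bar>g k x\<bar> \<le> \<bar>c\<bar>" for k x
      proof -
        have "\<bar>max 0 (1 - real k * infdist x K)\<bar> \<le> 1" using infdist_nonneg[of x K] by auto
        then show ?thesis unfolding g_def abs_mult
          using mult_left_mono[of "\<bar>max 0 (1 - real k * infdist x K)\<bar>" 1 "\<bar>c\<bar>"] by simp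
      qed
      have lip: "(\<bar>c\<bar> * real k)-lipschitz_on UNIV (g k)" for k
      proof (rule lipschitz_onI)
        fix x y :: 'a
        have "\<bar>max 0 (1 - real k * infdist x K) - max 0 (1 - real k * infdist y K)\<bar>
            \<le> \<bar>real k * infdist x K - real k * infdist y K\<bar>" by (auto simp: max_def)
        also have "\<dots> = real k * \<bar>infdist x K - infdist y K\<bar>"
          by (simp add: right_diff_distrib[symmetric] abs_mult)
        also have "\<dots> \<le> real k * dist x y" by (intro mult_left_mono infdist_triangle_abs) simp
        finally have "\<bar>c\<bar> * \<bar>max 0 (1 - real k * infdist x K) - max 0 (1 - real k * infdist y K)\<bar>
            \<le> \<bar>c\<bar> * (real k * dist x y)" by (rule mult_left_mono) simp
        then show "dist (g k x) (g k y) \<le> \<bar>c\<bar> * real k * dist x y"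
          by (simp add: g_def dist_real_def right_diff_distrib[symmetric] abs_mult mult.assoc)
      qed simp
      then have uc: "uniformly_continuous_on UNIV (g k)" for k
        by (rule lipschitz_on_uniformly_continuous)
      have [measurable]: "g k \<in> borel_measurable M" for k
        using uniformly_continuous_imp_continuous[OF uc]
        by (simp add: measurable_cong_sets[OF sets_M refl] borel_measurable_continuous_onI)
      have int: "integrable M (g k)" for k
        by (rule integrable_const_bound[of _ "\<bar>c\<bar>"]) (use g_le in auto)
      have lim: "(\<lambda>k. \<bar>indicator K x * c - g k x\<bar>) \<longlonglongrightarrow> 0" for x
      proof (cases "x \<in> K")
        case True
        then show ?thesis by (simp add: g_def)
      next
        case out: False
        then have pos: "infdist x K > 0"
          using K(1) False by (simp add: infdist_pos_not_in_closed compact_imp_closed)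
        obtain k0 :: nat where k0: "1 / infdist x K < real k0" using reals_Archimedean2 by blast
        have "\<forall>\<^sub>F k in sequentially. \<bar>indicator K x * c - g k x\<bar> = 0"
        proof (rule eventually_sequentiallyI)
          fix k assume "k0 \<le> k"
          then have "1 / infdist x K \<le> real k" using k0 by linarith
          then have "1 \<le> real k * infdist x K" using pos by (simp add: divide_le_eq)
          then show "\<bar>indicator K x * c - g k x\<bar> = 0" using out by (simp add: g_def)
        qed
        then show ?thesis by (rule tendsto_eventually)
      qed
      have "(\<lambda>k. \<integral>x. \<bar>indicator K x * c - g k x\<bar> \<partial>M) \<longlonglongrightarrow> (\<integral>x. 0 \<partial>M)"
      proof (rule integral_dominated_convergence[where w="\<lambda>_. 2 * \<bar>c\<bar>"])
        show "AE x in M. norm \<bar>indicator K x * c - g k x\<bar> \<le> 2 * \<bar>c\<bar>" for k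
        proof (rule AE_I2)
          fix x
          show "norm \<bar>indicator K x * c - g k x\<bar> \<le> 2 * \<bar>c\<bar>"
            using g_le[of k x] by (auto simp: indicator_def)
        qed
      qed (use lim in auto)
      then have "\<forall>\<^sub>F k in sequentially. (\<integral>x. \<bar>indicator K x * c - g k x\<bar> \<partial>M) < e / 2"
        using \<open>e > 0\<close> by (intro order_tendstoD) auto
      then obtain k where "(\<integral>x. \<bar>indicator K x * c - g k x\<bar> \<partial>M) < e / 2"
        by (auto simp: eventually_sequentially)
      then show ?thesis using uc int by blast
    qed
    then obtain g where g: "uniformly_continuous_on UNIV g" "integrable M g"
      "(\<integral>x. \<bar>indicator K x * c - g x\<bar> \<partial>M) < e / 2" by blast
    have [simp]: "integrable M (indicat_real B)" if "B \<in> sets M" for B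
      using that by (intro integrable_real_indicator) (simp_all add: emeasure_eq_measure)
    note [simp] = g(2)
    have "(\<integral>x. \<bar>indicator A x *\<^sub>R c - g x\<bar> \<partial>M)
        \<le> (\<integral>x. \<bar>indicator A x * c - indicator K x * c\<bar> + \<bar>indicator K x * c - g x\<bar> \<partial>M)"
      by (rule integral_mono) auto
    also have "\<dots> = (\<integral>x. \<bar>indicator A x * c - indicator K x * c\<bar> \<partial>M)
        + (\<integral>x. \<bar>indicator K x * c - g x\<bar> \<partial>M)"
      by (rule Bochner_Integration.integral_add) auto
    also have "\<dots> < e" using AK' g(3) by simp
    finally show ?case using g by auto
  next
    case (add f1 f2)
    obtain g1 where g1: "uniformly_continuous_on UNIV g1" "integrable M g1" "(\<integral>x. \<bar>f1 x - g1 x\<bar> \<partial>M) < e / 2"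
      using add.IH(1)[of "e / 2"] \<open>e > 0\<close> by auto
    obtain g2 where g2: "uniformly_continuous_on UNIV g2" "integrable M g2" "(\<integral>x. \<bar>f2 x - g2 x\<bar> \<partial>M) < e / 2"
      using add.IH(2)[of "e / 2"] \<open>e > 0\<close> by auto
    note [simp] = add.hyps g1(2) g2(2)
    have "(\<integral>x. \<bar>f1 x + f2 x - (g1 x + g2 x)\<bar> \<partial>M) \<le> (\<integral>x. \<bar>f1 x - g1 x\<bar> + \<bar>f2 x - g2 x\<bar> \<partial>M)"
      by (rule integral_mono) auto
    also have "\<dots> = (\<integral>x. \<bar>f1 x - g1 x\<bar> \<partial>M) + (\<integral>x. \<bar>f2 x - g2 x\<bar> \<partial>M)"
      by (rule Bochner_Integration.integral_add) auto
    also have "\<dots> < e" using g1(3) g2(3) by simp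
    finally show ?case using g1 g2
      by (intro exI[of _ "\<lambda>x. g1 x + g2 x"]) (auto intro: uniformly_continuous_on_add)
  next
    case (lim f s)
    note [simp] = lim.hyps(1,4)
    have "(\<lambda>i. \<integral>x. \<bar>f x - s i x\<bar> \<partial>M) \<longlonglongrightarrow> (\<integral>x. 0 \<partial>M)"
    proof (rule integral_dominated_convergence[where w="\<lambda>x. 3 * \<bar>f x\<bar>"])
      show "AE x in M. (\<lambda>i. \<bar>f x - s i x\<bar>) \<longlonglongrightarrow> 0"
      proof (rule AE_I2)
        fix x assume "x \<in> space M"
        from tendsto_diff[OF tendsto_const lim.hyps(2)[OF this], of "f x"]
        show "(\<lambda>i. \<bar>f x - s i x\<bar>) \<longlonglongrightarrow> 0" by (intro tendsto_rabs_zero) simp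
      qed
      show "AE x in M. norm \<bar>f x - s i x\<bar> \<le> 3 * \<bar>f x\<bar>" for i
      proof (rule AE_I2)
        fix x assume "x \<in> space M"
        from lim.hyps(3)[OF this, of i] show "norm \<bar>f x - s i x\<bar> \<le> 3 * \<bar>f x\<bar>" by auto
      qed
    qed (auto intro!: borel_measurable_abs borel_measurable_diff borel_measurable_integrable)
    then have "\<forall>\<^sub>F i in sequentially. (\<integral>x. \<bar>f x - s i x\<bar> \<partial>M) < e / 2"
      using \<open>e > 0\<close> by (intro order_tendstoD) auto
    then obtain i where i: "(\<integral>x. \<bar>f x - s i x\<bar> \<partial>M) < e / 2"
      by (auto simp: eventually_sequentially)
    obtain g where g: "uniformly_continuous_on UNIV g" "integrable M g" "(\<integral>x. \<bar>s i x - g x\<bar> \<partial>M) < e / 2"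
      using lim.IH[of "e / 2" i] \<open>e > 0\<close> by auto
    note [simp] = g(2)
    have "(\<integral>x. \<bar>f x - g x\<bar> \<partial>M) \<le> (\<integral>x. \<bar>f x - s i x\<bar> + \<bar>s i x - g x\<bar> \<partial>M)"
      by (rule integral_mono) auto
    also have "\<dots> = (\<integral>x. \<bar>f x - s i x\<bar> \<partial>M) + (\<integral>x. \<bar>s i x - g x\<bar> \<partial>M)"
      by (rule Bochner_Integration.integral_add) auto
    also have "\<dots> < e" using i g(3) by simp
    finally show ?case using g by auto
  }
qed

definition box_average :: "(real ^ 'd::finite) measure \<Rightarrow> (real ^ 'd \<Rightarrow> real) \<Rightarrow> real \<Rightarrow> int ^ 'd \<Rightarrow> real" where
  "box_average \<mu> f h j = (\<integral>x. indicator (grid_box h j) x * f x \<partial>\<mu>) / measure \<mu> (grid_box h j)"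

lemma dist_grid_box_le:
  fixes x z :: "real ^ 'd::finite"
  assumes "x \<in> grid_box h j" "z \<in> grid_box h j"
  shows "dist x z \<le> real CARD('d) * (2 * h)"
proof -
  have "dist x z \<le> (\<Sum>k\<in>UNIV. \<bar>(x - z) $ k\<bar>)" unfolding dist_norm by (rule norm_le_l1_cart)
  also have "\<dots> \<le> (\<Sum>k\<in>(UNIV::'d set). 2 * h)"
  proof (rule sum_mono)
    fix k :: 'd
    have "\<bar>x $ k - of_int (j $ k) * h\<bar> < h" "\<bar>z $ k - of_int (j $ k) * h\<bar> < h"
      using assms by (auto simp: mem_grid_box)
    then show "\<bar>(x - z) $ k\<bar> \<le> 2 * h" by simp
  qed
  finally show ?thesis by simp
qed

lemma sum_indicator_grid_cell_le:
  assumes "finite J" shows "(\<Sum>j\<in>J. indicator (grid_cell h j) x :: real) \<le> 1"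
proof -
  have "(\<Sum>j\<in>J. indicator (grid_cell h j) x :: real) = (\<Sum>j\<in>J. if j = nearest_index h x then 1 else 0)"
    by (intro sum.cong) (auto simp: grid_cell_def indicator_def)
  also have "\<dots> \<le> 1" using assms by simp
  finally show ?thesis .
qed

text \<open>
  On the cell, \<open>f\<close> differs from its box average by at most
  \<open>\<bar>f x - g x\<bar>\<close>, plus the oscillation of \<open>g\<close>, plus the average of \<open>\<bar>f - g\<bar>\<close> over the box.  Integrating the
  last, constant, term over the cell costs at most the integral of \<open>\<bar>f - g\<bar>\<close> over the box, since the cell
  is contained in the box.
\<close>

lemma box_average_deviation:
  fixes \<mu> :: "(real ^ 'd::finite) measure"
  assumes fin: "finite_measure \<mu>" and sets_mu: "sets \<mu> = sets borel"
    and f: "integrable \<mu> f" and g: "integrable \<mu> g" and h: "h > 0"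
    and osc: "\<And>x z. x \<in> grid_box h j \<Longrightarrow> z \<in> grid_box h j \<Longrightarrow> \<bar>g x - g z\<bar> \<le> e"
    and pos: "measure \<mu> (grid_box h j) > 0"
  shows "(\<integral>x. indicator (grid_cell h j) x * \<bar>f x - box_average \<mu> f h j\<bar> \<partial>\<mu>)
    \<le> (\<integral>x. indicator (grid_cell h j) x * \<bar>f x - g x\<bar> \<partial>\<mu>)
      + e * measure \<mu> (grid_cell h j) + (\<integral>x. indicator (grid_box h j) x * \<bar>f x - g x\<bar> \<partial>\<mu>)"
proof -
  interpret finite_measure \<mu> by (rule fin)
  have [measurable_cong]: "sets \<mu> = sets borel" by (rule sets_mu)
  note [simp] = f g
  have [measurable]: "f \<in> borel_measurable \<mu>" "g \<in> borel_measurable \<mu>" using borel_measurable_integrable f g by blast+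
  note h[measurable]
  let ?A = "grid_box h j" and ?C = "grid_cell h j"
  have CA: "?C \<subseteq> ?A" by (rule grid_cell_subset_grid_box[OF h])
  define m where "m = measure \<mu> ?A"
  define a where "a = box_average \<mu> f h j"
  define r where "r = (\<integral>x. indicator ?A x * \<bar>f x - g x\<bar> \<partial>\<mu>)"
  have m: "m > 0" using pos by (simp add: m_def)
  have intA: "integrable \<mu> (\<lambda>x. indicator ?A x * u x)" if "integrable \<mu> u" for u :: "_ \<Rightarrow> real"
    using integrable_mult_indicator[of ?A \<mu> u] that by simp
  have intC: "integrable \<mu> (\<lambda>x. indicator ?C x * u x)" if "integrable \<mu> u" for u :: "_ \<Rightarrow> real"
    using integrable_mult_indicator[of ?C \<mu> u] that by simp
  have r: "r \<ge> 0" unfolding r_def by (rule integral_nonneg_AE) auto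
  have near: "\<bar>g x - a\<bar> \<le> e + r / m" if x: "x \<in> ?C" for x
  proof -
    \<comment> \<open>Write \<open>g x - a\<close> as an average over \<open>z\<close> in the box of \<open>(g x - g z) + (g z - f z)\<close>.\<close>
    have xA: "x \<in> ?A" using x CA by auto
    have "(g x - a) * m = (\<integral>z. indicator ?A z * g x \<partial>\<mu>) - (\<integral>z. indicator ?A z * f z \<partial>\<mu>)"
      using m by (simp add: a_def box_average_def m_def left_diff_distrib)
    also have "\<dots> = (\<integral>z. indicator ?A z * g x - indicator ?A z * f z \<partial>\<mu>)"
      by (intro Bochner_Integration.integral_diff[symmetric] intA) auto
    also have "\<bar>\<dots>\<bar> \<le> (\<integral>z. \<bar>indicator ?A z * g x - indicator ?A z * f z\<bar> \<partial>\<mu>)"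
      by (rule integral_abs_bound)
    also have "\<dots> \<le> (\<integral>z. indicator ?A z * e + indicator ?A z * \<bar>f z - g z\<bar> \<partial>\<mu>)"
    proof (rule integral_mono)
      fix z
      show "\<bar>indicator ?A z * g x - indicator ?A z * f z\<bar> \<le> indicator ?A z * e + indicator ?A z * \<bar>f z - g z\<bar>"
        using osc[OF xA, of z] by (auto simp: indicator_def)
    qed (intro integrable_abs Bochner_Integration.integrable_diff Bochner_Integration.integrable_add intA; simp)+
    also have "\<dots> = e * m + r"
      by (subst Bochner_Integration.integral_add) (use intA[of "\<lambda>_. 1"] in \<open>auto intro!: intA simp: m_def r_def\<close>)
    finally have "\<bar>g x - a\<bar> * m \<le> e * m + r" using m by (simp add: abs_mult)
    then show ?thesis using m by (simp add: field_simps)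
  qed
  have "(\<integral>x. indicator ?C x * \<bar>f x - a\<bar> \<partial>\<mu>)
      \<le> (\<integral>x. indicator ?C x * \<bar>f x - g x\<bar> + indicator ?C x * (e + r / m) \<partial>\<mu>)"
  proof (rule integral_mono)
    fix x
    show "indicator ?C x * \<bar>f x - a\<bar> \<le> indicator ?C x * \<bar>f x - g x\<bar> + indicator ?C x * (e + r / m)"
      using near[of x] by (auto simp: indicator_def)
  qed (intro Bochner_Integration.integrable_add intC; simp)+
  also have "\<dots> = (\<integral>x. indicator ?C x * \<bar>f x - g x\<bar> \<partial>\<mu>) + (e + r / m) * measure \<mu> ?C"
    by (subst Bochner_Integration.integral_add) (use intC[of "\<lambda>_. 1"] in \<open>auto intro!: intC\<close>)
  also have "r / m * measure \<mu> ?C \<le> r"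
  proof -
    have "measure \<mu> ?C \<le> m" unfolding m_def by (rule finite_measure_mono[OF CA]) simp
    then have "r * measure \<mu> ?C \<le> r * m" using r by (rule mult_left_mono)
    then show ?thesis using m by (simp add: field_simps)
  qed
  then have "(e + r / m) * measure \<mu> ?C \<le> e * measure \<mu> ?C + r" by (simp add: distrib_right)
  finally show ?thesis unfolding a_def r_def by simp
qed

text \<open>
  Summing the preceding bound over boxes, the three terms become \<open>\<parallel>f - g\<parallel>\<^sub>1\<close>, the oscillation of \<open>g\<close> times
  the total mass, and at most \<open>3 ^ d * \<parallel>f - g\<parallel>\<^sub>1\<close>, for a uniformly continuous \<open>g\<close> close to \<open>f\<close>.
\<close>

lemma box_average_converges_L1:
  fixes \<mu> :: "(real ^ 'd::finite) measure"
  assumes fin: "finite_measure \<mu>" and sets_mu: "sets \<mu> = sets borel"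
    and f: "integrable \<mu> f" and e: "e > 0"
  shows "\<exists>\<delta>>0. \<forall>h J. 0 < h \<longrightarrow> h < \<delta> \<longrightarrow> finite J \<longrightarrow> (\<forall>j\<in>J. measure \<mu> (grid_box h j) > 0) \<longrightarrow>
    (\<Sum>j\<in>J. \<integral>x. indicator (grid_cell h j) x * \<bar>f x - box_average \<mu> f h j\<bar> \<partial>\<mu>) \<le> e"
proof -
  interpret finite_measure \<mu> by (rule fin)
  have [measurable_cong]: "sets \<mu> = sets borel" by (rule sets_mu)
  \<comment> \<open>The factor in front of \<open>\<parallel>f - g\<parallel>\<^sub>1\<close> in the final sum.\<close>
  define D :: real where "D = 1 + 3 ^ CARD('d)"
  have D: "D > 0" by (auto simp: D_def intro: add_pos_pos)
  define W where "W = measure \<mu> (space \<mu>)"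
  define e' where "e' = e / (2 * (W + 1))"
  have W: "W \<ge> 0" by (simp add: W_def)
  then have e': "e' > 0" "e' * W \<le> e / 2"
    using e by (auto simp: e'_def field_simps)
  obtain g where g: "uniformly_continuous_on UNIV g" "integrable \<mu> g" "(\<integral>x. \<bar>f x - g x\<bar> \<partial>\<mu>) < e / (2 * D)"
    using uniformly_continuous_dense_L1[OF fin sets_mu f, of "e / (2 * D)"] e D by auto
  obtain \<delta> where \<delta>: "\<delta> > 0" "\<And>x z. dist x z < \<delta> \<Longrightarrow> \<bar>g x - g z\<bar> < e'"
    using g(1) e'(1) unfolding uniformly_continuous_on_def by (metis UNIV_I dist_real_def dist_commute)
  note [simp] = f g(2)
  have [measurable]: "f \<in> borel_measurable \<mu>" "g \<in> borel_measurable \<mu>" using borel_measurable_integrable f g(2) by blast+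
  let ?s = "\<integral>x. \<bar>f x - g x\<bar> \<partial>\<mu>"
  show ?thesis
  proof (intro exI[of _ "\<delta> / (2 * CARD('d))"] conjI allI impI)
    show "\<delta> / (2 * CARD('d)) > 0" using \<delta>(1) by simp
    fix h :: real and J :: "(int ^ 'd) set"
    assume h: "0 < h" "h < \<delta> / (2 * CARD('d))" and J: "finite J" and pos: "\<forall>j\<in>J. measure \<mu> (grid_box h j) > 0"
    note h(1)[measurable]
    have intA: "integrable \<mu> (\<lambda>x. indicator (grid_box h j) x * u x)" if "integrable \<mu> u" for u :: "_ \<Rightarrow> real" and j
      using integrable_mult_indicator[of "grid_box h j" \<mu> u] that by simp
    have intC: "integrable \<mu> (\<lambda>x. indicator (grid_cell h j) x * u x)" if "integrable \<mu> u" for u :: "_ \<Rightarrow> real" and j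
      using integrable_mult_indicator[of "grid_cell h j" \<mu> u] that by simp
    have osc: "\<bar>g x - g z\<bar> \<le> e'" if "x \<in> grid_box h j" "z \<in> grid_box h j" for x z j
    proof -
      have "dist x z \<le> real CARD('d) * (2 * h)" using that by (rule dist_grid_box_le)
      also have "\<dots> < \<delta>" using h(2) by (simp add: field_simps)
      finally show ?thesis using \<delta>(2) less_imp_le by blast
    qed
    have "(\<Sum>j\<in>J. \<integral>x. indicator (grid_cell h j) x * \<bar>f x - box_average \<mu> f h j\<bar> \<partial>\<mu>)
      \<le> (\<Sum>j\<in>J. (\<integral>x. indicator (grid_cell h j) x * \<bar>f x - g x\<bar> \<partial>\<mu>)
          + e' * measure \<mu> (grid_cell h j) + (\<integral>x. indicator (grid_box h j) x * \<bar>f x - g x\<bar> \<partial>\<mu>))"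
      using pos osc by (intro sum_mono box_average_deviation[OF fin sets_mu f g(2) h(1)]) auto
    also have "\<dots> = (\<Sum>j\<in>J. \<integral>x. indicator (grid_cell h j) x * \<bar>f x - g x\<bar> \<partial>\<mu>)
          + e' * (\<Sum>j\<in>J. measure \<mu> (grid_cell h j)) + (\<Sum>j\<in>J. \<integral>x. indicator (grid_box h j) x * \<bar>f x - g x\<bar> \<partial>\<mu>)"
      by (simp add: sum.distrib sum_distrib_left)
    also have "(\<Sum>j\<in>J. \<integral>x. indicator (grid_cell h j) x * \<bar>f x - g x\<bar> \<partial>\<mu>) \<le> ?s"
    proof -
      have "(\<Sum>j\<in>J. \<integral>x. indicator (grid_cell h j) x * \<bar>f x - g x\<bar> \<partial>\<mu>)
          = (\<integral>x. (\<Sum>j\<in>J. indicator (grid_cell h j) x) * \<bar>f x - g x\<bar> \<partial>\<mu>)"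
        unfolding sum_distrib_right by (intro Bochner_Integration.integral_sum[symmetric] intC) auto
      also have "\<dots> \<le> ?s"
      proof (rule integral_mono)
        show "integrable \<mu> (\<lambda>x. (\<Sum>j\<in>J. indicator (grid_cell h j) x) * \<bar>f x - g x\<bar>)"
          unfolding sum_distrib_right by (intro Bochner_Integration.integrable_sum intC) auto
        show "(\<Sum>j\<in>J. indicator (grid_cell h j) x) * \<bar>f x - g x\<bar> \<le> \<bar>f x - g x\<bar>" for x
          using mult_right_mono[OF sum_indicator_grid_cell_le[OF J, of h x], of "\<bar>f x - g x\<bar>"] by simp
      qed auto
      finally show ?thesis .
    qed
    also have "(\<Sum>j\<in>J. \<integral>x. indicator (grid_box h j) x * \<bar>f x - g x\<bar> \<partial>\<mu>) \<le> 3 ^ CARD('d) * ?s"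
    proof -
      have "(\<Sum>j\<in>J. \<integral>x. indicator (grid_box h j) x * \<bar>f x - g x\<bar> \<partial>\<mu>)
          = (\<integral>x. (\<Sum>j\<in>J. indicator (grid_box h j) x) * \<bar>f x - g x\<bar> \<partial>\<mu>)"
        unfolding sum_distrib_right by (intro Bochner_Integration.integral_sum[symmetric] intA) auto
      also have "\<dots> \<le> (\<integral>x. 3 ^ CARD('d) * \<bar>f x - g x\<bar> \<partial>\<mu>)"
      proof (rule integral_mono)
        show "integrable \<mu> (\<lambda>x. (\<Sum>j\<in>J. indicator (grid_box h j) x) * \<bar>f x - g x\<bar>)"
          unfolding sum_distrib_right by (intro Bochner_Integration.integrable_sum intA) auto
        show "(\<Sum>j\<in>J. indicator (grid_box h j) x) * \<bar>f x - g x\<bar> \<le> 3 ^ CARD('d) * \<bar>f x - g x\<bar>" for x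
          by (intro mult_right_mono grid_box_overlap[OF h(1) J]) simp
      qed auto
      also have "\<dots> = 3 ^ CARD('d) * ?s" by simp
      finally show ?thesis .
    qed
    also have "e' * (\<Sum>j\<in>J. measure \<mu> (grid_cell h j)) \<le> e / 2"
    proof -
      have "(\<Sum>j\<in>J. measure \<mu> (grid_cell h j)) = measure \<mu> (\<Union>j\<in>J. grid_cell h j)"
        using J by (intro finite_measure_finite_Union[symmetric])
          (auto simp: disjoint_family_on_def grid_cell_def sets_mu grid_cell_measurable[OF h(1), unfolded grid_cell_def])
      also have "\<dots> \<le> W" unfolding W_def by (rule bounded_measure)
      finally have "e' * (\<Sum>j\<in>J. measure \<mu> (grid_cell h j)) \<le> e' * W"
        using e'(1) by (intro mult_left_mono) auto
      with e'(2) show ?thesis by linarith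
    qed
    finally have "(\<Sum>j\<in>J. \<integral>x. indicator (grid_cell h j) x * \<bar>f x - box_average \<mu> f h j\<bar> \<partial>\<mu>)
        \<le> ?s + e / 2 + 3 ^ CARD('d) * ?s" by simp
    also have "\<dots> = D * ?s + e / 2" by (simp add: D_def algebra_simps)
    also have "D * ?s \<le> e / 2"
      using g(3) D by (simp add: field_simps)
    finally show "(\<Sum>j\<in>J. \<integral>x. indicator (grid_cell h j) x * \<bar>f x - box_average \<mu> f h j\<bar> \<partial>\<mu>) \<le> e" by simp
  qed
qed

section \<open>Boxes of small mass\<close>

text \<open>
  Outside a large ball there is little mass.  The ball meets \<open>O(h ^ (- d))\<close> cells, and a cell whose box has mass
  below \<open>t * h ^ d\<close> has mass below \<open>t * h ^ d\<close> itself; together these have mass \<open>O(t)\<close>.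
\<close>

lemma light_boxes_negligible:
  fixes \<mu> :: "(real ^ 'd::finite) measure"
  assumes fin: "finite_measure \<mu>" and sets_mu: "sets \<mu> = sets borel" and e: "e > 0"
  shows "\<exists>t>0. \<forall>h. 0 < h \<longrightarrow> h \<le> 1 \<longrightarrow> (\<exists>G. finite G \<and>
    (\<forall>j\<in>G. t * h ^ CARD('d) \<le> measure \<mu> (grid_box h j)) \<and>
    measure \<mu> {x. nearest_index h x \<notin> G} \<le> e)"
proof -
  interpret finite_measure \<mu> by (rule fin)
  note [measurable_cong] = sets_mu
  have space_mu: "space \<mu> = UNIV" using sets_eq_imp_space_eq[OF sets_mu] by (simp only: space_borel)
  define W where "W i = {x :: real ^ 'd. norm x > real i}" for i :: nat
  have W [measurable]: "W i \<in> sets \<mu>" for i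
    unfolding sets_mu W_def by measurable
  have "(\<lambda>i. measure \<mu> (W i)) \<longlonglongrightarrow> measure \<mu> (\<Inter>i. W i)"
  proof (rule finite_Lim_measure_decseq)
    show "decseq W" by (rule decseq_SucI) (auto simp: W_def)
  qed (use W in auto)
  moreover have "(\<Inter>i. W i) = {}"
  proof (intro equals0I)
    fix x assume x: "x \<in> (\<Inter>i. W i)"
    obtain i where "norm x < real i" using reals_Archimedean2 by blast
    moreover have "real i < norm x" using x by (simp add: W_def)
    ultimately show False by simp
  qed
  ultimately have "(\<lambda>i. measure \<mu> (W i)) \<longlonglongrightarrow> 0" by simp
  then have "\<forall>\<^sub>F i in sequentially. measure \<mu> (W i) < e / 2"
    using e by (intro order_tendstoD) auto
  then obtain R where R: "measure \<mu> (W R) < e / 2" by (auto simp: eventually_sequentially)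
  define C where "C = (2 * real R + 3) ^ CARD('d)"
  have C: "C > 0" unfolding C_def by (intro zero_less_power) simp
  define t where "t = e / (2 * C)"
  have t: "t > 0" using e C by (simp add: t_def)
  show ?thesis
  proof (intro exI[of _ t] conjI allI impI)
    fix h :: real assume h: "0 < h" "h \<le> 1"
    define J where "J = {j :: int ^ 'd. \<forall>k. \<bar>(0 :: real ^ 'd) $ k - of_int (j $ k) * h\<bar> \<le> real R + 1}"
    define G where "G = {j \<in> J. t * h ^ CARD('d) \<le> measure \<mu> (grid_box h j)}"
    have J: "finite J" unfolding J_def by (rule finite_near_indices(1)[OF h(1)])
    have "real (card J) \<le> (2 * \<bar>real R + 1\<bar> / h + 1) ^ CARD('d)"
      unfolding J_def by (rule finite_near_indices(2)[OF h(1)])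
    also have "\<dots> \<le> ((2 * real R + 3) / h) ^ CARD('d)"
    proof (rule power_mono)
      have "1 \<le> 1 / h" using h by simp
      then have "2 * \<bar>real R + 1\<bar> / h + 1 \<le> 2 * (real R + 1) / h + 1 / h" by simp
      also have "\<dots> = (2 * real R + 3) / h" by (simp add: add_divide_distrib[symmetric])
      finally show "2 * \<bar>real R + 1\<bar> / h + 1 \<le> (2 * real R + 3) / h" .
    qed (use h in simp)
    also have "\<dots> = C / h ^ CARD('d)" by (simp add: C_def power_divide)
    finally have card: "real (card J) * h ^ CARD('d) \<le> C"
      using h by (simp add: pos_le_divide_eq)
    have cell [measurable]: "grid_cell h j \<in> sets \<mu>" for j
      unfolding sets_mu by (rule grid_cell_measurable[OF h(1)])
    have "{x. nearest_index h x \<notin> G} \<subseteq> W R \<union> (\<Union>j\<in>J - G. grid_cell h j)"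
    proof safe
      fix x assume x: "nearest_index h x \<notin> G" "x \<notin> (\<Union>j\<in>J - G. grid_cell h j)"
      then have "nearest_index h x \<notin> J" by (auto simp: grid_cell_def)
      then obtain k where "\<bar>of_int (nearest_index h x $ k) * h\<bar> > real R + 1" by (auto simp: J_def not_le)
      moreover have "x \<in> grid_box h (nearest_index h x)"
        using grid_cell_subset_grid_box[OF h(1)] by (auto simp: grid_cell_def)
      then have "\<bar>x $ k - of_int (nearest_index h x $ k) * h\<bar> < h" by (simp add: mem_grid_box)
      ultimately have "\<bar>x $ k\<bar> > real R" using h(2) by linarith
      then show "x \<in> W R" using component_le_norm_cart[of x k] by (simp add: W_def)
    qed
    then have "measure \<mu> {x. nearest_index h x \<notin> G} \<le> measure \<mu> (W R \<union> (\<Union>j\<in>J - G. grid_cell h j))"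
      using J by (intro finite_measure_mono) auto
    also have "\<dots> \<le> measure \<mu> (W R) + measure \<mu> (\<Union>j\<in>J - G. grid_cell h j)"
      using J by (intro measure_Un_le) auto
    also have "measure \<mu> (\<Union>j\<in>J - G. grid_cell h j) \<le> (\<Sum>j\<in>J - G. measure \<mu> (grid_cell h j))"
      using J by (intro measure_UNION_le) auto
    also have "\<dots> \<le> (\<Sum>j\<in>J - G. t * h ^ CARD('d))"
    proof (rule sum_mono)
      fix j assume j: "j \<in> J - G"
      have "measure \<mu> (grid_cell h j) \<le> measure \<mu> (grid_box h j)"
        by (intro finite_measure_mono grid_cell_subset_grid_box[OF h(1)]) (simp add: sets_mu)
      also have "\<dots> \<le> t * h ^ CARD('d)" using j by (auto simp: G_def)
      finally show "measure \<mu> (grid_cell h j) \<le> t * h ^ CARD('d)" .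
    qed
    also have "\<dots> \<le> real (card J) * (t * h ^ CARD('d))"
    proof -
      have "real (card (J - G)) \<le> real (card J)" using J by (intro of_nat_mono card_mono) auto
      then show ?thesis using t h by (simp add: mult_right_mono)
    qed
    also have "\<dots> = t * (real (card J) * h ^ CARD('d))" by simp
    also have "\<dots> \<le> t * C" using card t by (intro mult_left_mono) auto
    also have "t * C = e / 2" using C by (simp add: t_def)
    finally have "measure \<mu> {x. nearest_index h x \<notin> G} \<le> e" using R by simp
    then show "\<exists>G. finite G \<and> (\<forall>j\<in>G. t * h ^ CARD('d) \<le> measure \<mu> (grid_box h j)) \<and>
        measure \<mu> {x. nearest_index h x \<notin> G} \<le> e"
      using J by (intro exI[of _ G]) (auto simp: G_def)
  qed (rule t)
qed

section \<open>Laplace moments and sums of independent variables\<close>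

text \<open>
  Up to the null set \<open>{0}\<close>, the Laplace density is the mean of an exponential density and its reflection.
\<close>

lemma has_bochner_integral_laplace_moment:
  assumes b: "b > 0"
  shows "has_bochner_integral lborel (\<lambda>z. laplace_density b z * z ^ k) ((1 + (-1) ^ k) * fact k / (2 * b ^ k))"
proof -
  let ?e = "erlang_density 0 b"
  have right: "has_bochner_integral lborel (\<lambda>z. ?e z * z ^ k) (fact k / b ^ k)"
  proof (rule has_bochner_integral_nn_integral)
    show "(\<integral>\<^sup>+ z. ennreal (?e z * z ^ k) \<partial>lborel) = ennreal (fact k / b ^ k)"
      using nn_integral_erlang_ith_moment[OF b, of 0 k] by simp
    show "AE z in lborel. 0 \<le> ?e z * z ^ k" using b by (auto simp: erlang_density_def)
    show "0 \<le> fact k / b ^ k" using b by simp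
  qed simp
  have left: "has_bochner_integral lborel (\<lambda>z. ?e (- z) * (- z) ^ k) (fact k / b ^ k)"
    using lborel_has_bochner_integral_real_affine_iff[of "-1" "\<lambda>z. ?e z * z ^ k" "fact k / b ^ k" 0] right
    by simp
  have sum: "has_bochner_integral lborel (\<lambda>z. (?e z * z ^ k + (-1) ^ k * (?e (- z) * (- z) ^ k)) / 2)
      ((fact k / b ^ k + (-1) ^ k * (fact k / b ^ k)) / 2)"
    by (intro has_bochner_integral_divide_zero has_bochner_integral_add has_bochner_integral_mult_right right left)
  have "AE z in lborel. (?e z * z ^ k + (-1) ^ k * (?e (- z) * (- z) ^ k)) / 2 = laplace_density b z * z ^ k"
    using AE_lborel_singleton[of 0]
  proof eventually_elim
    case (elim z)
    have "(-1) ^ k * (- z) ^ k = z ^ k" by (simp add: power_mult_distrib[symmetric])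
    then have "(-1) ^ k * (?e (- z) * (- z) ^ k) = ?e (- z) * z ^ k" by (metis mult.left_commute)
    moreover have "?e z + ?e (- z) = 2 * laplace_density b z"
      using elim by (auto simp: erlang_density_def laplace_density_def)
    ultimately show ?case by (simp only: distrib_right[symmetric])
  qed
  with sum have "has_bochner_integral lborel (\<lambda>z. laplace_density b z * z ^ k)
      ((fact k / b ^ k + (-1) ^ k * (fact k / b ^ k)) / 2)"
    by (subst has_bochner_integral_cong_AE[symmetric]) (auto simp: laplace_density_def)
  moreover have "(fact k / b ^ k + (-1) ^ k * (fact k / b ^ k)) / 2 = (1 + (-1) ^ k) * fact k / (2 * b ^ k)"
    using b by (simp add: divide_simps) (simp add: algebra_simps)
  ultimately show ?thesis by metis
qed

lemma (in prob_space) laplace_moments: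
  assumes b: "b > 0" and D: "distributed M lborel X (laplace_density b)"
  shows "integrable M X" "expectation X = 0" "integrable M (\<lambda>\<omega>. (X \<omega>)\<^sup>2)" "expectation (\<lambda>\<omega>. (X \<omega>)\<^sup>2) = 2 / b\<^sup>2"
proof -
  have nn: "0 \<le> laplace_density b z" for z using b by (simp add: laplace_density_def)
  have pw: "(\<lambda>z::real. z ^ k) \<in> borel_measurable lborel" for k by simp
  note I = has_bochner_integral_laplace_moment[OF b]
  show "integrable M X" "expectation X = 0"
    using distributed_integrable[OF D pw[of 1]] distributed_integral[OF D pw[of 1]] I[of 1] nn
    by (auto simp: has_bochner_integral_iff)
  show "integrable M (\<lambda>\<omega>. (X \<omega>)\<^sup>2)" "expectation (\<lambda>\<omega>. (X \<omega>)\<^sup>2) = 2 / b\<^sup>2"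
    using distributed_integrable[OF D pw[of 2]] distributed_integral[OF D pw[of 2]] I[of 2] nn
    by (auto simp: has_bochner_integral_iff)
qed

lemma (in prob_space) indep_sum_second_moment:
  fixes X :: "'i \<Rightarrow> 'a \<Rightarrow> real"
  assumes "finite I" "indep_vars (\<lambda>_. borel) X I"
    and "\<And>i. i \<in> I \<Longrightarrow> integrable M (X i)" "\<And>i. i \<in> I \<Longrightarrow> expectation (X i) = 0"
    and "\<And>i. i \<in> I \<Longrightarrow> integrable M (\<lambda>\<omega>. (X i \<omega>)\<^sup>2)"
  shows "integrable M (\<lambda>\<omega>. (\<Sum>i\<in>I. X i \<omega>)\<^sup>2) \<and>
    expectation (\<lambda>\<omega>. (\<Sum>i\<in>I. X i \<omega>)\<^sup>2) = (\<Sum>i\<in>I. expectation (\<lambda>\<omega>. (X i \<omega>)\<^sup>2))"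
  using assms
proof (induction I rule: finite_induct)
  case (insert i I)
  let ?S = "\<lambda>\<omega>. \<Sum>i\<in>I. X i \<omega>"
  have "indep_vars (\<lambda>_. borel) X I" by (rule indep_vars_subset[OF insert.prems(1)]) auto
  then have IH: "integrable M (\<lambda>\<omega>. (?S \<omega>)\<^sup>2)"
    "expectation (\<lambda>\<omega>. (?S \<omega>)\<^sup>2) = (\<Sum>i\<in>I. expectation (\<lambda>\<omega>. (X i \<omega>)\<^sup>2))"
    using insert by auto
  have S: "integrable M ?S" "expectation ?S = 0" using insert.prems by (auto simp: integral_sum)
  have ind: "indep_var borel (X i) borel ?S"
    by (rule indep_vars_sum[OF insert.hyps insert.prems(1)])
  have X: "integrable M (X i)" "expectation (X i) = 0" "integrable M (\<lambda>\<omega>. (X i \<omega>)\<^sup>2)"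
    using insert.prems by auto
  have cross: "integrable M (\<lambda>\<omega>. X i \<omega> * ?S \<omega>)" "expectation (\<lambda>\<omega>. X i \<omega> * ?S \<omega>) = 0"
    using indep_var_integrable[OF ind X(1) S(1)] indep_var_lebesgue_integral[OF ind X(1) S(1)] S(2) by auto
  have eq: "(\<lambda>\<omega>. (\<Sum>i\<in>insert i I. X i \<omega>)\<^sup>2) = (\<lambda>\<omega>. (X i \<omega>)\<^sup>2 + 2 * (X i \<omega> * ?S \<omega>) + (?S \<omega>)\<^sup>2)"
    using insert.hyps by (auto simp: fun_eq_iff power2_sum)
  show ?case
    unfolding eq using X(3) cross IH insert.hyps by simp
qed simp

lemma (in prob_space) expectation_abs_le_sqrt:
  fixes X :: "'a \<Rightarrow> real"
  assumes "integrable M X" "integrable M (\<lambda>\<omega>. (X \<omega>)\<^sup>2)"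
  shows "expectation (\<lambda>\<omega>. \<bar>X \<omega>\<bar>) \<le> sqrt (expectation (\<lambda>\<omega>. (X \<omega>)\<^sup>2))"
proof -
  have "variance (\<lambda>\<omega>. \<bar>X \<omega>\<bar>) = expectation (\<lambda>\<omega>. (X \<omega>)\<^sup>2) - (expectation (\<lambda>\<omega>. \<bar>X \<omega>\<bar>))\<^sup>2"
    using assms by (subst variance_eq) auto
  then have "(expectation (\<lambda>\<omega>. \<bar>X \<omega>\<bar>))\<^sup>2 \<le> expectation (\<lambda>\<omega>. (X \<omega>)\<^sup>2)"
    using variance_positive[of "\<lambda>\<omega>. \<bar>X \<omega>\<bar>"] by simp
  then show ?thesis by (rule real_le_rsqrt)
qed

text \<open>
  A sign that differs from the sign of \<open>m\<close> forces \<open>\<bar>T - m\<bar> \<ge> \<bar>m\<bar>\<close>, so this is Markov's inequality.  Taking the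
  factor \<open>\<bar>m\<bar>\<close> to the left avoids any lower bound on the margin.
\<close>

lemma (in prob_space) wrong_sign_probability:
  assumes T: "integrable M T"
  shows "\<bar>prob {\<omega> \<in> space M. T \<omega> < 0} - of_bool (m < 0)\<bar> * \<bar>m\<bar> \<le> expectation (\<lambda>\<omega>. \<bar>T \<omega> - m\<bar>)"
proof -
  have [measurable]: "T \<in> borel_measurable M" using T by (rule borel_measurable_integrable)
  define E where "E = (if m < 0 then {\<omega> \<in> space M. \<not> T \<omega> < 0} else {\<omega> \<in> space M. T \<omega> < 0})"
  have [measurable]: "E \<in> events" by (simp add: E_def)
  have "\<bar>prob {\<omega> \<in> space M. T \<omega> < 0} - of_bool (m < 0)\<bar> = prob E"
    by (simp add: E_def prob_neg)
  then have "\<bar>prob {\<omega> \<in> space M. T \<omega> < 0} - of_bool (m < 0)\<bar> * \<bar>m\<bar> = expectation (\<lambda>\<omega>. indicator E \<omega> * \<bar>m\<bar>)"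
    by simp
  also have "\<dots> \<le> expectation (\<lambda>\<omega>. \<bar>T \<omega> - m\<bar>)"
  proof (rule integral_mono)
    show "integrable M (\<lambda>\<omega>. indicator E \<omega> * \<bar>m\<bar>)"
      by (intro integrable_mult_left integrable_real_indicator) (auto simp: emeasure_eq_measure)
    show "indicator E \<omega> * \<bar>m\<bar> \<le> \<bar>T \<omega> - m\<bar>" for \<omega>
      by (auto simp: E_def indicator_def)
  qed (use T in auto)
  finally show ?thesis .
qed

section \<open>Labels and the regression function\<close>

lemma labelled_distributionD:
  fixes P :: "((real ^ 'd::finite) \<times> nat) measure"
  assumes "labelled_distribution P"
  shows "prob_space P" "sets P = sets (borel \<Otimes>\<^sub>M count_space {0, 1})" "space P = UNIV \<times> {0, 1}"
proof -
  show P: "prob_space P" "sets P = sets (borel \<Otimes>\<^sub>M count_space {0, 1})"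
    using assms unfolding labelled_distribution_def labelled_space_def by blast+
  have "space P = space (borel \<Otimes>\<^sub>M count_space {0, 1})"
    by (rule sets_eq_imp_space_eq[OF P(2)])
  also have "\<dots> = UNIV \<times> {0, 1}"
    by (simp only: space_pair_measure space_borel space_count_space)
  finally show "space P = UNIV \<times> {0, 1}" .
qed

lemma labelled_distribution_coordinates:
  fixes P :: "((real ^ 'd::finite) \<times> nat) measure"
  assumes P: "labelled_distribution P"
  shows "fst \<in> P \<rightarrow>\<^sub>M borel" "(\<lambda>z. real (snd z)) \<in> P \<rightarrow>\<^sub>M borel"
proof -
  show "fst \<in> P \<rightarrow>\<^sub>M borel"
    unfolding measurable_cong_sets[OF labelled_distributionD(2)[OF P] refl] by (rule measurable_fst)
  show "(\<lambda>z. real (snd z)) \<in> P \<rightarrow>\<^sub>M borel"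
    unfolding measurable_cong_sets[OF labelled_distributionD(2)[OF P] refl]
    by (rule measurable_compose[OF measurable_snd]) simp
qed

text \<open>
  The defining property of conditional expectation, transported from the \<open>\<sigma>\<close>-algebra generated by the first
  coordinate to the law of that coordinate.
\<close>

lemma regression_function_integral:
  fixes P :: "((real ^ 'd::finite) \<times> nat) measure" and B :: "(real ^ 'd) set"
  assumes P: "labelled_distribution P" and eta: "regression_function P \<eta>"
  shows "integrable (distr P borel fst) \<eta>"
    and "B \<in> sets borel \<Longrightarrow> measure P (B \<times> {1}) = (\<integral>x. indicator B x * \<eta> x \<partial>distr P borel fst)"
proof -
  interpret P: prob_space P by (rule labelled_distributionD[OF P])
  note [measurable_cong] = labelled_distributionD(2)[OF P]
  have fst[measurable]: "fst \<in> P \<rightarrow>\<^sub>M borel" by measurable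
  have [measurable]: "\<eta> \<in> borel_measurable borel" using eta by (simp add: regression_function_def)
  let ?F = "vimage_algebra (space P) fst (borel :: (real ^ 'd) measure)"
  have setsF: "sets ?F = {fst -` A \<inter> space P | A. A \<in> sets borel}"
    by (rule sets_vimage_algebra2) auto
  have "subalgebra P ?F"
    unfolding subalgebra_def setsF using measurable_sets[OF fst] by auto
  then interpret F: finite_measure_subalgebra P ?F
    by unfold_locales
  let ?y = "\<lambda>z :: (real ^ 'd) \<times> nat. of_bool (snd z = 1) :: real"
  have y: "integrable P ?y"
    by (rule P.integrable_const_bound[of _ 1]) auto
  have AE: "AE z in P. \<eta> (fst z) = real_cond_exp P ?F ?y z"
    using eta by (simp add: regression_function_def)
  have "integrable P (\<lambda>z. \<eta> (fst z))"
  proof (rule integrable_cong_AE_imp[OF F.real_cond_exp_int(1)[OF y]])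
    show "AE z in P. real_cond_exp P ?F ?y z = \<eta> (fst z)" using AE by eventually_elim simp
  qed measurable
  then show "integrable (distr P borel fst) \<eta>" by (simp add: integrable_distr_eq)
  assume B[measurable]: "B \<in> sets borel"
  let ?A = "fst -` B \<inter> space P"
  have "?A \<in> sets ?F" using B by (auto simp: setsF)
  then have "(\<integral>z. indicator ?A z * ?y z \<partial>P) = (\<integral>z. indicator ?A z * real_cond_exp P ?F ?y z \<partial>P)"
    using F.real_cond_exp_intA[OF y] by (simp add: set_lebesgue_integral_def)
  also have "\<dots> = (\<integral>z. indicator B (fst z) * \<eta> (fst z) \<partial>P)"
  proof (rule integral_cong_AE)
    show "AE z in P. indicator ?A z * real_cond_exp P ?F ?y z = indicator B (fst z) * \<eta> (fst z)"
      using AE AE_space by eventually_elim (simp add: indicator_def)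
  qed measurable
  also have "\<dots> = (\<integral>x. indicator B x * \<eta> x \<partial>distr P borel fst)"
    by (simp add: integral_distr)
  also have "(\<integral>z. indicator ?A z * ?y z \<partial>P) = (\<integral>z. indicator (B \<times> {1}) z \<partial>P)"
    by (intro Bochner_Integration.integral_cong) (auto simp: indicator_def)
  also have "\<dots> = measure P (B \<times> {1})"
    by (simp add: labelled_distributionD(3)[OF P] Times_Int_Times)
  finally show "measure P (B \<times> {1}) = (\<integral>x. indicator B x * \<eta> x \<partial>distr P borel fst)" .
qed

lemma measure_label_zero:
  fixes P :: "((real ^ 'd::finite) \<times> nat) measure"
  assumes P: "labelled_distribution P" and eta: "regression_function P \<eta>" and B: "B \<in> sets borel"
  shows "measure P (B \<times> {0}) = (\<integral>x. indicator B x * (1 - \<eta> x) \<partial>distr P borel fst)"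
proof -
  interpret P: prob_space P by (rule labelled_distributionD(1)[OF P])
  let ?\<mu> = "distr P borel fst"
  have fst: "fst \<in> P \<rightarrow>\<^sub>M borel" by (rule labelled_distribution_coordinates(1)[OF P])
  interpret \<mu>: prob_space ?\<mu> by (rule P.prob_space_distr[OF fst])
  have mP: "B \<times> {y} \<in> sets P" if "y \<in> {0, 1}" for y
    unfolding labelled_distributionD(2)[OF P] using B that by (intro pair_measureI) auto
  have "measure ?\<mu> B = measure P (fst -` B \<inter> space P)" by (rule measure_distr[OF fst B])
  also have "fst -` B \<inter> space P = B \<times> {0} \<union> B \<times> {1}"
    by (auto simp: labelled_distributionD(3)[OF P])
  also have "measure P \<dots> = measure P (B \<times> {0}) + measure P (B \<times> {1})"
    by (rule P.finite_measure_Union[OF mP mP]) auto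
  also have "measure P (B \<times> {1}) = (\<integral>x. indicator B x * \<eta> x \<partial>?\<mu>)"
    by (rule regression_function_integral(2)[OF P eta B])
  finally have "measure P (B \<times> {0}) = measure ?\<mu> B - (\<integral>x. indicator B x * \<eta> x \<partial>?\<mu>)" by simp
  also have "\<dots> = (\<integral>x. indicator B x - indicator B x * \<eta> x \<partial>?\<mu>)"
  proof -
    have B': "B \<in> sets ?\<mu>" using B by simp
    have "integrable ?\<mu> (indicat_real B)"
      by (rule integrable_real_indicator[OF B']) (simp add: \<mu>.emeasure_eq_measure)
    then show ?thesis
      using integrable_mult_indicator[OF B' regression_function_integral(1)[OF P eta]]
      by (subst Bochner_Integration.integral_diff) auto
  qed
  also have "\<dots> = (\<integral>x. indicator B x * (1 - \<eta> x) \<partial>?\<mu>)"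
    by (intro Bochner_Integration.integral_cong) (auto simp: algebra_simps)
  finally show ?thesis .
qed

section \<open>The statistic of a box\<close>

text \<open>
  The test statistic averages the first \<open>n\<close> reports and the last \<open>n\<close> reports with different weights;
  one weight per index turns it into a single sum over all \<open>2n\<close> reports.
\<close>

definition slot_weight :: "nat \<Rightarrow> nat \<Rightarrow> real" where
  "slot_weight n i = (if i \<le> n then - (1 / (2 * real n)) else 1 / real n)"

definition slot_signal :: "nat \<Rightarrow> real \<Rightarrow> int ^ 'd \<Rightarrow> nat \<Rightarrow> (real ^ 'd::finite) \<times> nat \<Rightarrow> real" where
  "slot_signal n h j i z = (if i \<le> n then 1 else real (snd z)) * indicator (grid_box h j) (fst z)"

text \<open>
  The value of the test statistic at every test point whose nearest grid index is \<open>j\<close>.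
\<close>

definition box_stat ::
  "nat \<Rightarrow> real \<Rightarrow> (nat \<Rightarrow> 'w \<Rightarrow> (real ^ 'd::finite) \<times> nat) \<Rightarrow> (nat \<Rightarrow> int ^ 'd \<Rightarrow> 'w \<Rightarrow> real) \<Rightarrow>
    int ^ 'd \<Rightarrow> 'w \<Rightarrow> real" where
  "box_stat n h S \<epsilon> j \<omega> = (\<Sum>i\<in>{1..2*n}. slot_weight n i * (slot_signal n h j i (S i \<omega>) + \<epsilon> i j \<omega>))"

lemma sum_two_samples:
  fixes u :: "nat \<Rightarrow> real"
  shows "(\<Sum>i\<in>{1..2*n}. slot_weight n i * u i)
    = 1 / real n * (\<Sum>i=n+1..2*n. u i) - 1 / (2 * real n) * (\<Sum>i=1..n. u i)"
proof -
  have "{1..2*n} = {1..n} \<union> {n+1..2*n}" by auto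
  then have "(\<Sum>i\<in>{1..2*n}. slot_weight n i * u i)
      = (\<Sum>i=1..n. slot_weight n i * u i) + (\<Sum>i=n+1..2*n. slot_weight n i * u i)"
    by (simp only:) (rule sum.union_disjoint, auto)
  also have "(\<Sum>i=1..n. slot_weight n i * u i) = - (1 / (2 * real n)) * (\<Sum>i=1..n. u i)"
    unfolding sum_distrib_left by (rule sum.cong) (auto simp: slot_weight_def)
  also have "(\<Sum>i=n+1..2*n. slot_weight n i * u i) = 1 / real n * (\<Sum>i=n+1..2*n. u i)"
    unfolding sum_distrib_left by (rule sum.cong) (auto simp: slot_weight_def)
  finally show ?thesis by simp
qed

lemma test_stat_eq_box_stat:
  "test_stat n h (privatised n h S \<epsilon> \<omega>) x = box_stat n h S \<epsilon> (nearest_index h x) \<omega>"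
  unfolding test_stat_def box_stat_def sum_two_samples[symmetric]
  by (intro sum.cong) (auto simp: privatised_def slot_signal_def box_indicator_eq)

lemma privacy_modelD:
  fixes P :: "((real ^ 'd::finite) \<times> nat) measure"
  assumes "privacy_model P n \<alpha> M S \<epsilon>"
  shows "prob_space M"
    and "\<And>i. i \<le> 2 * n \<Longrightarrow> S i \<in> M \<rightarrow>\<^sub>M P"
    and "\<And>i. i \<le> 2 * n \<Longrightarrow> distr M P (S i) = P"
    and "\<And>i j. i \<in> {1..2*n} \<Longrightarrow> distributed M lborel (\<epsilon> i j) (laplace_density (\<alpha> / 2 ^ (CARD('d) + 1)))"
  using assms unfolding privacy_model_def by auto

text \<open>
  Observations and noise live in different types; composing them with real functions puts them into one
  independent family, to which the usual statements on sums apply.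
\<close>

lemma privacy_model_indep_vars:
  fixes P :: "((real ^ 'd::finite) \<times> nat) measure"
  assumes model: "privacy_model P n \<alpha> M S \<epsilon>"
    and \<phi>: "\<And>i. i \<in> {0..2*n} \<Longrightarrow> \<phi> i \<in> P \<rightarrow>\<^sub>M borel"
    and \<psi>: "\<And>i. i \<in> {1..2*n} \<Longrightarrow> \<psi> i \<in> borel \<rightarrow>\<^sub>M borel"
  shows "prob_space.indep_vars M (\<lambda>_. borel)
    (case_sum (\<lambda>i \<omega>. \<phi> i (S i \<omega>)) (\<lambda>(i, j) \<omega>. \<psi> i (\<epsilon> i j \<omega>))) ({0..2*n} <+> ({1..2*n} \<times> UNIV))"
proof -
  interpret prob_space M by (rule privacy_modelD(1)[OF model])
  have S: "S i \<in> M \<rightarrow>\<^sub>M P" if "i \<in> {0..2*n}" for i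
    using privacy_modelD(2)[OF model] that by auto
  have eps: "\<epsilon> i j \<in> M \<rightarrow>\<^sub>M borel" if "i \<in> {1..2*n}" for i j
    using distributed_measurable[OF privacy_modelD(4)[OF model that]] by simp
  have ind: "indep_sets
      (case_sum (\<lambda>i. {S i -` A \<inter> space M | A. A \<in> sets P}) (\<lambda>(i, j). {\<epsilon> i j -` A \<inter> space M | A. A \<in> sets borel}))
      ({0..2*n} <+> ({1..2*n} \<times> UNIV))"
    using model unfolding privacy_model_def by blast
  let ?K = "{0..2*n} <+> ({1..2*n} \<times> (UNIV :: (int ^ 'd) set))"
  let ?X = "case_sum (\<lambda>i \<omega>. \<phi> i (S i \<omega>)) (\<lambda>(i, j) \<omega>. \<psi> i (\<epsilon> i j \<omega>))"
  have K_cases: "(\<exists>i. k = Inl i \<and> i \<in> {0..2*n}) \<or> (\<exists>i j. k = Inr (i, j) \<and> i \<in> {1..2*n})" if "k \<in> ?K" for k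
    using that by (elim PlusE) auto
  show ?thesis
    unfolding indep_vars_def2
  proof (intro conjI ballI)
    fix k assume "k \<in> ?K"
    then consider i where "k = Inl i" "i \<in> {0..2*n}" | i j where "k = Inr (i, j)" "i \<in> {1..2*n}"
      using K_cases by blast
    then show "random_variable borel (?X k)"
    proof cases
      case 1
      show ?thesis unfolding 1(1) sum.case by (rule measurable_compose[OF S \<phi>]) (rule 1(2))+
    next
      case 2
      show ?thesis unfolding 2(1) sum.case prod.case by (rule measurable_compose[OF eps \<psi>]) (rule 2(2))+
    qed
  next
    show "indep_sets (\<lambda>k. {?X k -` A \<inter> space M | A. A \<in> sets borel}) ?K"
    proof (rule indep_sets_mono_sets[OF ind], rule subsetI)
      fix k E assume "k \<in> ?K" and E: "E \<in> {?X k -` A \<inter> space M | A. A \<in> sets borel}"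
      from E obtain A where A: "A \<in> sets borel" "E = ?X k -` A \<inter> space M" by blast
      from \<open>k \<in> ?K\<close> consider i where "k = Inl i" "i \<in> {0..2*n}" | i j where "k = Inr (i, j)" "i \<in> {1..2*n}"
        using K_cases by blast
      then show "E \<in> case_sum (\<lambda>i. {S i -` A \<inter> space M | A. A \<in> sets P}) (\<lambda>(i, j). {\<epsilon> i j -` A \<inter> space M | A. A \<in> sets borel}) k"
      proof cases
        case 1
        have "E = S i -` (\<phi> i -` A \<inter> space P) \<inter> space M"
          using measurable_space[OF S[OF 1(2)]] unfolding A(2) 1(1) sum.case by auto
        moreover have "\<phi> i -` A \<inter> space P \<in> sets P"
          by (rule measurable_sets[OF \<phi>[OF 1(2)] A(1)])
        ultimately show ?thesis unfolding 1(1) sum.case by blast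
      next
        case 2
        have "E = \<epsilon> i j -` (\<psi> i -` A) \<inter> space M"
          unfolding A(2) 2(1) sum.case prod.case by auto
        moreover have "\<psi> i -` A \<in> sets borel"
          using measurable_sets[OF \<psi>[OF 2(2)] A(1)] by simp
        ultimately show ?thesis unfolding 2(1) sum.case prod.case by blast
      qed
    qed
  qed
qed

lemma slot_signal_measurable:
  fixes P :: "((real ^ 'd::finite) \<times> nat) measure"
  assumes P: "labelled_distribution P"
  shows "slot_signal n h j i \<in> P \<rightarrow>\<^sub>M borel"
proof -
  note labelled_distribution_coordinates[OF P, measurable]
  show ?thesis by (cases "i \<le> n") (simp_all add: slot_signal_def[abs_def])
qed

lemma slot_signal_range:
  fixes P :: "((real ^ 'd::finite) \<times> nat) measure"
  assumes P: "labelled_distribution P" and z: "z \<in> space P"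
  shows "0 \<le> slot_signal n h j i z" "slot_signal n h j i z \<le> 1"
  using z unfolding labelled_distributionD(3)[OF P] by (auto simp: slot_signal_def indicator_def)

lemma (in prob_space) unit_variable_moments:
  fixes X :: "'a \<Rightarrow> real"
  assumes X: "X \<in> borel_measurable M" and range: "\<And>\<omega>. \<omega> \<in> space M \<Longrightarrow> 0 \<le> X \<omega> \<and> X \<omega> \<le> 1"
  shows "integrable M X"
    and "integrable M (\<lambda>\<omega>. (X \<omega> - expectation X)\<^sup>2)"
    and "expectation (\<lambda>\<omega>. (X \<omega> - expectation X)\<^sup>2) \<le> 1"
proof -
  note X[measurable]
  show int: "integrable M X"
    by (rule integrable_const_bound[of _ 1]) (use range in \<open>auto intro!: AE_I2\<close>)
  have int2: "integrable M (\<lambda>\<omega>. (X \<omega>)\<^sup>2)"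
    by (rule integrable_const_bound[of _ 1]) (use range in \<open>auto intro!: AE_I2 power_le_one\<close>)
  show "integrable M (\<lambda>\<omega>. (X \<omega> - expectation X)\<^sup>2)"
    unfolding power2_diff using int int2 by simp
  have "variance X = expectation (\<lambda>\<omega>. (X \<omega>)\<^sup>2) - (expectation X)\<^sup>2"
    using int int2 by (rule variance_eq)
  also have "\<dots> \<le> expectation (\<lambda>\<omega>. (X \<omega>)\<^sup>2)" by simp
  also have "\<dots> \<le> expectation (\<lambda>\<omega>. 1)"
    by (rule integral_mono[OF int2]) (use range in \<open>auto intro!: power_le_one\<close>)
  finally show "expectation (\<lambda>\<omega>. (X \<omega> - expectation X)\<^sup>2) \<le> 1" by (simp add: prob_space)
qed

lemma mean_slot_signal:
  fixes P :: "((real ^ 'd::finite) \<times> nat) measure"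
  assumes P: "labelled_distribution P" and eta: "regression_function P \<eta>"
  defines "\<mu> \<equiv> distr P borel fst"
  shows "(\<integral>z. slot_signal n h j i z \<partial>P)
    = (if i \<le> n then measure \<mu> (grid_box h j) else (\<integral>x. indicator (grid_box h j) x * \<eta> x \<partial>\<mu>))"
proof -
  interpret P: prob_space P by (rule labelled_distributionD(1)[OF P])
  have fst: "fst \<in> P \<rightarrow>\<^sub>M borel"
    by (rule labelled_distribution_coordinates(1)[OF P])
  show ?thesis
  proof (cases "i \<le> n")
    case True
    have "(\<integral>z. slot_signal n h j i z \<partial>P) = (\<integral>z. indicator (grid_box h j) (fst z) \<partial>P)"
      using True by (simp add: slot_signal_def)
    also have "\<dots> = (\<integral>x. indicator (grid_box h j) x \<partial>\<mu>)"
      unfolding \<mu>_def by (rule integral_distr[symmetric, OF fst]) measurable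
    also have "\<dots> = measure \<mu> (grid_box h j)"
      by (simp add: \<mu>_def)
    finally show ?thesis using True by simp
  next
    case False
    have "(\<integral>z. slot_signal n h j i z \<partial>P) = (\<integral>z. indicator (grid_box h j \<times> {1}) z \<partial>P)"
      using False
      by (intro Bochner_Integration.integral_cong)
        (auto simp: slot_signal_def indicator_def labelled_distributionD(3)[OF P])
    also have "\<dots> = measure P (grid_box h j \<times> {1})"
      by (simp add: labelled_distributionD(3)[OF P] Times_Int_Times)
    finally show ?thesis
      using False regression_function_integral(2)[OF P eta grid_box_measurable] by (simp add: \<mu>_def)
  qed
qed

text \<open>
  Averaging \<open>Y * B - B / 2\<close> gives half of \<open>(2 * \<eta> - 1) * B\<close>, where \<open>B\<close> is the indicator of the box.
\<close>

lemma mean_box_stat: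
  fixes P :: "((real ^ 'd::finite) \<times> nat) measure"
  assumes P: "labelled_distribution P" and eta: "regression_function P \<eta>" and n: "n > 0"
  defines "\<mu> \<equiv> distr P borel fst"
  shows "(\<Sum>i\<in>{1..2*n}. slot_weight n i * (\<integral>z. slot_signal n h j i z \<partial>P))
    = (\<integral>x. indicator (grid_box h j) x * (2 * \<eta> x - 1) \<partial>\<mu>) / 2"
proof -
  interpret P: prob_space P by (rule labelled_distributionD(1)[OF P])
  have fst: "fst \<in> P \<rightarrow>\<^sub>M borel"
    by (rule labelled_distribution_coordinates(1)[OF P])
  interpret \<mu>: prob_space \<mu> unfolding \<mu>_def by (rule P.prob_space_distr[OF fst])
  let ?A = "grid_box h j"
  have A: "?A \<in> sets \<mu>" and space_mu: "space \<mu> = UNIV" by (simp_all add: \<mu>_def)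
  have ind: "integrable \<mu> (indicat_real ?A)"
    by (rule integrable_real_indicator[OF A]) (simp add: \<mu>.emeasure_eq_measure)
  have int: "integrable \<mu> \<eta>" unfolding \<mu>_def by (rule regression_function_integral(1)[OF P eta])
  have "(\<integral>x. indicator ?A x * (2 * \<eta> x - 1) \<partial>\<mu>) = (\<integral>x. 2 * (indicator ?A x * \<eta> x) - indicator ?A x \<partial>\<mu>)"
    by (intro Bochner_Integration.integral_cong) (auto simp: algebra_simps)
  also have "\<dots> = 2 * (\<integral>x. indicator ?A x * \<eta> x \<partial>\<mu>) - measure \<mu> ?A"
    using integrable_mult_indicator[OF A int] ind
    by (subst Bochner_Integration.integral_diff) (auto simp: space_mu)
  finally show ?thesis
    unfolding sum_two_samples mean_slot_signal[OF P eta] using n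
    by (simp add: \<mu>_def[symmetric] field_simps)
qed

text \<open>
  Apart from its mean, \<open>box_stat\<close> is a sum of \<open>4n\<close> independent centred variables: \<open>2n\<close> signals with variance at
  most \<open>1 / n\<^sup>2\<close> and \<open>2n\<close> noise terms with variance at most \<open>(2 / b\<^sup>2) / n\<^sup>2\<close>.  The test pair
  belongs to the same independent family, which yields the product formula.
\<close>

lemma box_stat_concentration:
  fixes P :: "((real ^ 'd::finite) \<times> nat) measure" and j :: "int ^ 'd" and h :: real
  assumes P: "labelled_distribution P" and eta: "regression_function P \<eta>"
    and model: "privacy_model P n \<alpha> M S \<epsilon>" and n: "n > 0" and \<alpha>: "\<alpha> > 0"
    and B: "B \<in> sets P" and U: "U \<in> sets borel"
  defines "\<mu> \<equiv> distr P borel fst" and "T \<equiv> box_stat n h S \<epsilon> j"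
  shows "integrable M T"
    and "measure M {\<omega> \<in> space M. S 0 \<omega> \<in> B \<and> T \<omega> \<in> U} = measure P B * measure M {\<omega> \<in> space M. T \<omega> \<in> U}"
    and "(\<integral>\<omega>. \<bar>T \<omega> - (\<integral>x. indicator (grid_box h j) x * (2 * \<eta> x - 1) \<partial>\<mu>) / 2\<bar> \<partial>M)
      \<le> sqrt (2 * (1 + 8 * 4 ^ CARD('d) / \<alpha>\<^sup>2) / real n)"
proof -
  interpret prob_space M by (rule privacy_modelD(1)[OF model])
  interpret P: prob_space P by (rule labelled_distributionD(1)[OF P])
  define b where "b = \<alpha> / 2 ^ (CARD('d) + 1)"
  have b: "b > 0" using \<alpha> by (simp add: b_def)
  define q where "q i = (\<integral>z. slot_signal n h j i z \<partial>P)" for i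
  define c where "c = slot_weight n"
  \<comment> \<open>Index \<open>0\<close> is the test pair, of which only the event \<open>B\<close> matters.\<close>
  define \<phi> where "\<phi> i z = (if i = 0 then indicator B z else c i * (slot_signal n h j i z - q i))" for i z
  define V :: "nat + nat \<times> (int ^ 'd) \<Rightarrow> _ \<Rightarrow> real"
    where "V = case_sum (\<lambda>i \<omega>. \<phi> i (S i \<omega>)) (\<lambda>(i, j) \<omega>. c i * \<epsilon> i j \<omega>)"
  define K :: "(nat + nat \<times> (int ^ 'd)) set" where "K = {1..2*n} <+> ({1..2*n} \<times> {j})"
  define m where "m = (\<Sum>i\<in>{1..2*n}. c i * q i)"
  have m: "m = (\<integral>x. indicator (grid_box h j) x * (2 * \<eta> x - 1) \<partial>\<mu>) / 2"
    unfolding m_def c_def q_def \<mu>_def by (rule mean_box_stat[OF P eta n])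
  have S: "S i \<in> M \<rightarrow>\<^sub>M P" "distr M P (S i) = P" if "i \<le> 2 * n" for i
    using privacy_modelD(2,3)[OF model that] .
  note sig = slot_signal_measurable[OF P]
  have \<phi>: "\<phi> i \<in> P \<rightarrow>\<^sub>M borel" for i
  proof (cases "i = 0")
    case True
    then show ?thesis using B by (simp add: \<phi>_def[abs_def])
  next
    case False
    then show ?thesis using sig[of n h j i] by (simp add: \<phi>_def[abs_def])
  qed
  have "indep_vars (\<lambda>_. borel) V ({0..2*n} <+> ({1..2*n} \<times> UNIV))"
    unfolding V_def by (rule privacy_model_indep_vars[OF model]) (auto intro: \<phi>)
  then have ind: "indep_vars (\<lambda>_. borel) V (insert (Inl 0) K)"
    by (rule indep_vars_subset) (auto simp: K_def)
  have K: "finite K" "Inl 0 \<notin> K" by (auto simp: K_def)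
  \<comment> \<open>The signals are centred inside \<open>\<phi>\<close>; the noise has mean \<open>0\<close> already.\<close>
  have decomp: "T \<omega> = m + (\<Sum>k\<in>K. V k \<omega>)" for \<omega>
  proof -
    have "{1..2*n} \<times> {j} = (\<lambda>i. (i, j)) ` {1..2*n}" by auto
    then have pr: "(\<Sum>p\<in>{1..2*n} \<times> {j}. V (Inr p) \<omega>) = (\<Sum>i\<in>{1..2*n}. V (Inr (i, j)) \<omega>)"
      by (simp only:) (subst sum.reindex, auto simp: inj_on_def)
    have "(\<Sum>k\<in>K. V k \<omega>) = (\<Sum>i\<in>{1..2*n}. V (Inl i) \<omega>) + (\<Sum>i\<in>{1..2*n}. V (Inr (i, j)) \<omega>)"
      unfolding K_def pr[symmetric] by (subst sum.Plus) (auto simp: comp_def)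
    also have "(\<Sum>i\<in>{1..2*n}. V (Inl i) \<omega>) = (\<Sum>i\<in>{1..2*n}. c i * (slot_signal n h j i (S i \<omega>) - q i))"
      by (rule sum.cong) (auto simp: V_def \<phi>_def)
    also have "(\<Sum>i\<in>{1..2*n}. V (Inr (i, j)) \<omega>) = (\<Sum>i\<in>{1..2*n}. c i * \<epsilon> i j \<omega>)"
      by (simp add: V_def)
    finally show ?thesis
      by (simp add: T_def box_stat_def m_def c_def[symmetric] sum.distrib[symmetric] sum_subtractf algebra_simps)
  qed
  have c2: "(c i)\<^sup>2 \<le> 1 / (real n)\<^sup>2" for i
    using n by (auto simp: c_def slot_weight_def power_divide intro!: divide_left_mono)
  have V: "integrable M (V k) \<and> expectation (V k) = 0 \<and> integrable M (\<lambda>\<omega>. (V k \<omega>)\<^sup>2) \<and>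
      expectation (\<lambda>\<omega>. (V k \<omega>)\<^sup>2) \<le> (case k of Inl _ \<Rightarrow> 1 | Inr _ \<Rightarrow> 2 / b\<^sup>2) / (real n)\<^sup>2" if k: "k \<in> K" for k
    using k unfolding K_def
  proof (elim PlusE)
    fix i assume i: "k = Inl i" "i \<in> {1..2*n}"
    have Vk: "V k = (\<lambda>\<omega>. c i * (slot_signal n h j i (S i \<omega>) - q i))"
      using i by (auto simp: V_def \<phi>_def)
    have iS: "S i \<in> M \<rightarrow>\<^sub>M P" "distr M P (S i) = P" using S[of i] i by auto
    note mom = P.unit_variable_moments[OF sig[of n h j i], folded q_def]
    have range: "0 \<le> slot_signal n h j i z \<and> slot_signal n h j i z \<le> 1" if "z \<in> space P" for z
      using slot_signal_range[OF P that] by simp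
    have t: "integrable M (\<lambda>\<omega>. u (S i \<omega>)) \<and> expectation (\<lambda>\<omega>. u (S i \<omega>)) = (\<integral>z. u z \<partial>P)"
      if u: "integrable P u" for u :: "_ \<Rightarrow> real"
      using integrable_distr_eq[OF iS(1) borel_measurable_integrable[OF u]]
        integral_distr[OF iS(1) borel_measurable_integrable[OF u]] u
      by (simp add: iS(2))
    have 1: "integrable M (\<lambda>\<omega>. slot_signal n h j i (S i \<omega>))" "expectation (\<lambda>\<omega>. slot_signal n h j i (S i \<omega>)) = q i"
      using t[OF mom(1)[OF range]] by (auto simp: q_def)
    have 2: "integrable M (\<lambda>\<omega>. (slot_signal n h j i (S i \<omega>) - q i)\<^sup>2)"
      "expectation (\<lambda>\<omega>. (slot_signal n h j i (S i \<omega>) - q i)\<^sup>2) \<le> 1"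
      using t[OF mom(2)[OF range]] mom(3)[OF range] by auto
    have "(c i)\<^sup>2 * expectation (\<lambda>\<omega>. (slot_signal n h j i (S i \<omega>) - q i)\<^sup>2) \<le> 1 / (real n)\<^sup>2 * 1"
      by (intro mult_mono c2 2(2)) auto
    then show ?thesis
      unfolding Vk using 1 2(1) i(1) by (simp add: power_mult_distrib prob_space)
  next
    fix p assume p: "k = Inr p" "p \<in> {1..2*n} \<times> {j}"
    define i where "i = fst p"
    have i: "i \<in> {1..2*n}" "p = (i, j)" using p by (auto simp: i_def)
    have Vk: "V k = (\<lambda>\<omega>. c i * \<epsilon> i j \<omega>)" using p(1) i(2) by (simp add: V_def)
    note lap = laplace_moments[OF b privacy_modelD(4)[OF model i(1), of j, folded b_def]]
    have "(c i)\<^sup>2 * (2 / b\<^sup>2) \<le> 1 / (real n)\<^sup>2 * (2 / b\<^sup>2)"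
      by (intro mult_right_mono c2) auto
    then show ?thesis
      unfolding Vk using lap p(1) by (simp add: power_mult_distrib mult.commute)
  qed
  have indK: "indep_vars (\<lambda>_. borel) V K" by (rule indep_vars_subset[OF ind]) auto
  have sum2: "integrable M (\<lambda>\<omega>. (\<Sum>k\<in>K. V k \<omega>)\<^sup>2)"
    "expectation (\<lambda>\<omega>. (\<Sum>k\<in>K. V k \<omega>)\<^sup>2) = (\<Sum>k\<in>K. expectation (\<lambda>\<omega>. (V k \<omega>)\<^sup>2))"
    using indep_sum_second_moment[OF K(1) indK] V by auto
  have sum1: "integrable M (\<lambda>\<omega>. \<Sum>k\<in>K. V k \<omega>)" using V by (intro Bochner_Integration.integrable_sum) auto
  have T_eq: "T = (\<lambda>\<omega>. m + (\<Sum>k\<in>K. V k \<omega>))" using decomp by auto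
  show "integrable M T" unfolding T_eq using sum1 by simp
  have "(\<integral>\<omega>. \<bar>T \<omega> - m\<bar> \<partial>M) = expectation (\<lambda>\<omega>. \<bar>\<Sum>k\<in>K. V k \<omega>\<bar>)"
    by (simp add: decomp)
  also have "\<dots> \<le> sqrt (expectation (\<lambda>\<omega>. (\<Sum>k\<in>K. V k \<omega>)\<^sup>2))"
    by (rule expectation_abs_le_sqrt[OF sum1 sum2(1)])
  also have "\<dots> \<le> sqrt (2 * (1 + 8 * 4 ^ CARD('d) / \<alpha>\<^sup>2) / real n)"
  proof (rule real_sqrt_le_mono)
    have "expectation (\<lambda>\<omega>. (\<Sum>k\<in>K. V k \<omega>)\<^sup>2) \<le> (\<Sum>k\<in>K. (case k of Inl _ \<Rightarrow> 1 | Inr _ \<Rightarrow> 2 / b\<^sup>2) / (real n)\<^sup>2)"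
      unfolding sum2(2) using V by (intro sum_mono) auto
    also have "\<dots> = 2 * real n * (1 / (real n)\<^sup>2) + 2 * real n * (2 / b\<^sup>2 / (real n)\<^sup>2)"
      unfolding K_def by (subst sum.Plus) (auto simp: card_cartesian_product)
    also have "\<dots> = 2 * (1 + 2 / b\<^sup>2) / real n"
      using n b by (simp add: field_simps power2_eq_square)
    also have "2 / b\<^sup>2 = 8 * 4 ^ CARD('d) / \<alpha>\<^sup>2"
    proof -
      have "((2::real) ^ m)\<^sup>2 = 4 ^ m" for m
        by (simp add: power2_eq_square power_mult_distrib[symmetric])
      then have "b\<^sup>2 = \<alpha>\<^sup>2 / 4 ^ (CARD('d) + 1)" unfolding b_def power_divide by simp
      then show ?thesis by simp
    qed
    finally show "expectation (\<lambda>\<omega>. (\<Sum>k\<in>K. V k \<omega>)\<^sup>2) \<le> 2 * (1 + 8 * 4 ^ CARD('d) / \<alpha>\<^sup>2) / real n" .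
  qed
  finally show "(\<integral>\<omega>. \<bar>T \<omega> - (\<integral>x. indicator (grid_box h j) x * (2 * \<eta> x - 1) \<partial>\<mu>) / 2\<bar> \<partial>M)
      \<le> sqrt (2 * (1 + 8 * 4 ^ CARD('d) / \<alpha>\<^sup>2) / real n)"
    unfolding m .
  have "indep_var borel (V (Inl 0)) borel (\<lambda>\<omega>. \<Sum>k\<in>K. V k \<omega>)"
    by (rule indep_vars_sum[OF K ind])
  then have "indep_var borel (V (Inl 0)) borel ((\<lambda>x. m + x) \<circ> (\<lambda>\<omega>. \<Sum>k\<in>K. V k \<omega>))"
    using indep_var_compose[of borel "V (Inl 0)" borel _ "\<lambda>x. x" borel "\<lambda>x. m + x" borel] by (simp add: comp_def)
  then have ind0: "indep_var borel (V (Inl 0)) borel T" by (simp add: T_eq comp_def)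
  have V0: "V (Inl 0) \<omega> = indicator B (S 0 \<omega>)" for \<omega> by (simp add: V_def \<phi>_def)
  have "prob ((\<lambda>\<omega>. (V (Inl 0) \<omega>, T \<omega>)) -` ({1} \<times> U) \<inter> space M)
      = prob (V (Inl 0) -` {1} \<inter> space M) * prob (T -` U \<inter> space M)"
    by (rule indep_varD[OF ind0]) (use U in auto)
  moreover have "(\<lambda>\<omega>. (V (Inl 0) \<omega>, T \<omega>)) -` ({1} \<times> U) \<inter> space M = {\<omega> \<in> space M. S 0 \<omega> \<in> B \<and> T \<omega> \<in> U}"
    by (auto simp: V0 indicator_def split: if_splits)
  moreover have "T -` U \<inter> space M = {\<omega> \<in> space M. T \<omega> \<in> U}" by auto
  moreover have "prob (V (Inl 0) -` {1} \<inter> space M) = measure P B"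
  proof -
    have "V (Inl 0) -` {1} \<inter> space M = S 0 -` B \<inter> space M"
      by (auto simp: V0 indicator_def split: if_splits)
    also have "prob \<dots> = measure (distr M P (S 0)) B"
      by (rule measure_distr[symmetric, OF S(1)]) (use B in auto)
    finally show ?thesis by (simp add: S(2))
  qed
  ultimately show "measure M {\<omega> \<in> space M. S 0 \<omega> \<in> B \<and> T \<omega> \<in> U} = measure P B * measure M {\<omega> \<in> space M. T \<omega> \<in> U}"
    by simp
qed

section \<open>Excess risk\<close>

text \<open>
  Only finitely many values of \<open>J\<close> are compared in detail; on the rest, two probabilities differ by at most the
  probability of the rest.
\<close>

lemma (in prob_space) prob_difference_by_cells:
  assumes D: "D \<in> events" and E: "E \<in> events" and J: "J \<in> M \<rightarrow>\<^sub>M count_space UNIV" and G: "finite G"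
  shows "\<bar>prob D - prob E\<bar> \<le>
    (\<Sum>j\<in>G. \<bar>prob {\<omega> \<in> D. J \<omega> = j} - prob {\<omega> \<in> E. J \<omega> = j}\<bar>) + prob {\<omega> \<in> space M. J \<omega> \<notin> G}"
proof -
  have JG [measurable]: "{\<omega> \<in> space M. J \<omega> \<in> H} \<in> events" for H
    using measurable_sets[OF J, of H] by (simp add: vimage_def Int_def conj_commute)
  have part: "{\<omega> \<in> A. J \<omega> \<in> H} \<in> events" if "A \<in> events" for A H
  proof -
    have "{\<omega> \<in> A. J \<omega> \<in> H} = A \<inter> {\<omega> \<in> space M. J \<omega> \<in> H}"
      using sets.sets_into_space[OF that] by auto
    then show ?thesis using that by auto
  qed
  have split: "prob A = (\<Sum>j\<in>G. prob {\<omega> \<in> A. J \<omega> = j}) + prob {\<omega> \<in> A. J \<omega> \<notin> G}" if A: "A \<in> events" for A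
  proof -
    have m: "{\<omega> \<in> A. J \<omega> = j} \<in> events" for j using part[OF A, of "{j}"] by simp
    have m': "{\<omega> \<in> A. J \<omega> \<notin> G} \<in> events" using part[OF A, of "- G"] by simp
    have "A = (\<Union>j\<in>G. {\<omega> \<in> A. J \<omega> = j}) \<union> {\<omega> \<in> A. J \<omega> \<notin> G}" by auto
    then have "prob A = prob ((\<Union>j\<in>G. {\<omega> \<in> A. J \<omega> = j}) \<union> {\<omega> \<in> A. J \<omega> \<notin> G})" by simp
    also have "\<dots> = prob (\<Union>j\<in>G. {\<omega> \<in> A. J \<omega> = j}) + prob {\<omega> \<in> A. J \<omega> \<notin> G}"
      using m m' G by (intro finite_measure_Union) auto
    also have "prob (\<Union>j\<in>G. {\<omega> \<in> A. J \<omega> = j}) = (\<Sum>j\<in>G. prob {\<omega> \<in> A. J \<omega> = j})"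
      using m G by (intro finite_measure_finite_Union) (auto simp: disjoint_family_on_def)
    finally show ?thesis .
  qed
  have rest: "prob {\<omega> \<in> A. J \<omega> \<notin> G} \<le> prob {\<omega> \<in> space M. J \<omega> \<notin> G}" if "A \<in> events" for A
    using JG[of "- G"] sets.sets_into_space[OF that] by (intro finite_measure_mono) auto
  have "\<bar>prob D - prob E\<bar> \<le> \<bar>\<Sum>j\<in>G. prob {\<omega> \<in> D. J \<omega> = j} - prob {\<omega> \<in> E. J \<omega> = j}\<bar>
      + \<bar>prob {\<omega> \<in> D. J \<omega> \<notin> G} - prob {\<omega> \<in> E. J \<omega> \<notin> G}\<bar>"
    unfolding split[OF D] split[OF E] sum_subtractf by linarith
  also have "\<dots> \<le> (\<Sum>j\<in>G. \<bar>prob {\<omega> \<in> D. J \<omega> = j} - prob {\<omega> \<in> E. J \<omega> = j}\<bar>) + prob {\<omega> \<in> space M. J \<omega> \<notin> G}"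
  proof (intro add_mono sum_abs)
    show "\<bar>prob {\<omega> \<in> D. J \<omega> \<notin> G} - prob {\<omega> \<in> E. J \<omega> \<notin> G}\<bar> \<le> prob {\<omega> \<in> space M. J \<omega> \<notin> G}"
      using rest[OF D] rest[OF E] measure_nonneg[of M "{\<omega> \<in> D. J \<omega> \<notin> G}"]
        measure_nonneg[of M "{\<omega> \<in> E. J \<omega> \<notin> G}"] by linarith
  qed
  finally show ?thesis .
qed

text \<open>
  The comparison of a random sign (negative with probability \<open>p\<close>) with the sign of \<open>f\<close>, carried out via a
  proxy \<open>a\<close>.  If \<open>a\<close> and \<open>f\<close> have the same sign, replace \<open>\<bar>f\<bar>\<close> by \<open>\<bar>a\<bar> + \<bar>f - a\<bar>\<close>; otherwise \<open>\<bar>f\<bar> \<le> \<bar>f - a\<bar>\<close>.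
\<close>

lemma plug_in_error_le:
  fixes p f a :: real
  assumes "0 \<le> p" "p \<le> 1"
  shows "\<bar>(p - of_bool (f < 0)) * f\<bar> \<le> \<bar>p - of_bool (a < 0)\<bar> * \<bar>a\<bar> + 2 * \<bar>f - a\<bar>"
proof (cases "(f < 0) = (a < 0)")
  case True
  have q: "\<bar>p - of_bool (a < 0)\<bar> \<le> 1" using assms by (auto simp: of_bool_def)
  have "\<bar>(p - of_bool (f < 0)) * f\<bar> \<le> \<bar>p - of_bool (a < 0)\<bar> * (\<bar>a\<bar> + \<bar>f - a\<bar>)"
    unfolding True abs_mult by (intro mult_left_mono) auto
  also have "\<dots> \<le> \<bar>p - of_bool (a < 0)\<bar> * \<bar>a\<bar> + 1 * \<bar>f - a\<bar>"
    unfolding distrib_left by (intro add_left_mono mult_right_mono q) auto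
  also have "\<dots> \<le> \<bar>p - of_bool (a < 0)\<bar> * \<bar>a\<bar> + 2 * \<bar>f - a\<bar>" by simp
  finally show ?thesis .
next
  case False
  have "\<bar>p - of_bool (f < 0)\<bar> * \<bar>f\<bar> \<le> 1 * \<bar>f\<bar>"
    using assms by (intro mult_right_mono) (auto simp: of_bool_def)
  also have "\<dots> \<le> \<bar>f - a\<bar>" using False by auto
  also have "\<dots> \<le> \<bar>p - of_bool (a < 0)\<bar> * \<bar>a\<bar> + 2 * \<bar>f - a\<bar>" by simp
  finally show ?thesis by (simp add: abs_mult)
qed

text \<open>
  On \<open>C\<close> the random classifier answers \<open>0\<close> with a fixed probability \<open>p\<close>, and so its conditional risk at \<open>x\<close> is
  \<open>\<eta> x * p + (1 - \<eta> x) * (1 - p)\<close>.  The difference to the conditional Bayes risk is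
  \<open>(p - of_bool (\<eta> x < 1 / 2)) * (2 * \<eta> x - 1)\<close>.
\<close>

lemma cell_risk_difference:
  fixes P :: "((real ^ 'd::finite) \<times> nat) measure" and C :: "(real ^ 'd) set"
  assumes P: "labelled_distribution P" and eta: "regression_function P \<eta>" and C: "C \<in> sets borel"
    and p: "0 \<le> p" "p \<le> 1"
  defines "\<mu> \<equiv> distr P borel fst"
  shows "\<bar>(measure P (C \<times> {1}) * p + measure P (C \<times> {0}) * (1 - p))
      - (measure P ((C \<inter> {x. \<eta> x < 1 / 2}) \<times> {1}) + measure P ((C \<inter> {x. \<eta> x \<ge> 1 / 2}) \<times> {0}))\<bar>
    \<le> \<bar>p - of_bool (a < 0)\<bar> * \<bar>a\<bar> * measure \<mu> C + 2 * (\<integral>x. indicator C x * \<bar>2 * \<eta> x - 1 - a\<bar> \<partial>\<mu>)"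
proof -
  interpret P: prob_space P by (rule labelled_distributionD(1)[OF P])
  have fst: "fst \<in> P \<rightarrow>\<^sub>M borel" by (rule labelled_distribution_coordinates(1)[OF P])
  interpret \<mu>: prob_space \<mu> unfolding \<mu>_def by (rule P.prob_space_distr[OF fst])
  have \<eta>[measurable]: "\<eta> \<in> borel_measurable borel" using eta by (simp add: regression_function_def)
  have int: "integrable \<mu> \<eta>" unfolding \<mu>_def by (rule regression_function_integral(1)[OF P eta])
  note C[measurable]
  let ?L = "{x. \<eta> x < 1 / 2}" and ?H = "{x. \<eta> x \<ge> 1 / 2}"
  have L: "C \<inter> ?L \<in> sets borel" "C \<inter> ?H \<in> sets borel" by measurable
  have intB: "integrable \<mu> (\<lambda>x. indicator B x * u x)" if "B \<in> sets borel" "integrable \<mu> u" for B and u :: "_ \<Rightarrow> real"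
    using integrable_mult_indicator[OF _ that(2), of B] that(1) by (simp add: \<mu>_def)
  have m1: "measure P (B \<times> {1}) = (\<integral>x. indicator B x * \<eta> x \<partial>\<mu>)" if "B \<in> sets borel" for B
    unfolding \<mu>_def by (rule regression_function_integral(2)[OF P eta that])
  have m0: "measure P (B \<times> {0}) = (\<integral>x. indicator B x * (1 - \<eta> x) \<partial>\<mu>)" if "B \<in> sets borel" for B
    unfolding \<mu>_def by (rule measure_label_zero[OF P eta that])
  have int0: "integrable \<mu> (\<lambda>x. 1 - \<eta> x)" using int by simp
  define q where "q = \<bar>p - of_bool (a < 0)\<bar> * \<bar>a\<bar>"
  define u where "u x = \<bar>2 * \<eta> x - 1 - a\<bar>" for x
  have "integrable \<mu> u" unfolding u_def
    by (intro integrable_abs Bochner_Integration.integrable_diff integrable_mult_right int \<mu>.integrable_const)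
  then have intu: "integrable \<mu> (\<lambda>x. indicator C x * u x)" by (rule intB[OF C])
  have intq: "integrable \<mu> (\<lambda>x. indicator C x * q)" by (rule intB[OF C \<mu>.integrable_const])
  have "(measure P (C \<times> {1}) * p + measure P (C \<times> {0}) * (1 - p))
      - (measure P ((C \<inter> ?L) \<times> {1}) + measure P ((C \<inter> ?H) \<times> {0}))
    = (\<integral>x. (indicator C x * \<eta> x * p + indicator C x * (1 - \<eta> x) * (1 - p))
      - (indicator (C \<inter> ?L) x * \<eta> x + indicator (C \<inter> ?H) x * (1 - \<eta> x)) \<partial>\<mu>)"
  proof -
    note hb = has_bochner_integral_integrable
    note c1 = hb[OF intB[OF C int]] and c0 = hb[OF intB[OF C int0]]
      and l1 = hb[OF intB[OF L(1) int]] and h0 = hb[OF intB[OF L(2) int0]]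
    have "has_bochner_integral \<mu> (\<lambda>x. indicator C x * \<eta> x * p + indicator C x * (1 - \<eta> x) * (1 - p))
        ((\<integral>x. indicator C x * \<eta> x \<partial>\<mu>) * p + (\<integral>x. indicator C x * (1 - \<eta> x) \<partial>\<mu>) * (1 - p))"
      by (rule has_bochner_integral_add; rule has_bochner_integral_mult_left, rule c1 c0)
    moreover have "has_bochner_integral \<mu> (\<lambda>x. indicator (C \<inter> ?L) x * \<eta> x + indicator (C \<inter> ?H) x * (1 - \<eta> x))
        ((\<integral>x. indicator (C \<inter> ?L) x * \<eta> x \<partial>\<mu>) + (\<integral>x. indicator (C \<inter> ?H) x * (1 - \<eta> x) \<partial>\<mu>))"
      by (rule has_bochner_integral_add[OF l1 h0])
    ultimately have "has_bochner_integral \<mu> (\<lambda>x. (indicator C x * \<eta> x * p + indicator C x * (1 - \<eta> x) * (1 - p))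
        - (indicator (C \<inter> ?L) x * \<eta> x + indicator (C \<inter> ?H) x * (1 - \<eta> x)))
      (((\<integral>x. indicator C x * \<eta> x \<partial>\<mu>) * p + (\<integral>x. indicator C x * (1 - \<eta> x) \<partial>\<mu>) * (1 - p))
        - ((\<integral>x. indicator (C \<inter> ?L) x * \<eta> x \<partial>\<mu>) + (\<integral>x. indicator (C \<inter> ?H) x * (1 - \<eta> x) \<partial>\<mu>)))"
      by (rule has_bochner_integral_diff)
    then show ?thesis
      unfolding m1[OF C] m0[OF C] m1[OF L(1)] m0[OF L(2)] by (rule has_bochner_integral_integral_eq[symmetric])
  qed
  also have "\<dots> = (\<integral>x. indicator C x * ((p - of_bool (2 * \<eta> x - 1 < 0)) * (2 * \<eta> x - 1)) \<partial>\<mu>)"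
  proof (intro Bochner_Integration.integral_cong refl)
    fix x
    have sgn: "2 * \<eta> x - 1 < 0 \<longleftrightarrow> \<eta> x < 1 / 2" by auto
    show "(indicator C x * \<eta> x * p + indicator C x * (1 - \<eta> x) * (1 - p))
      - (indicator (C \<inter> ?L) x * \<eta> x + indicator (C \<inter> ?H) x * (1 - \<eta> x))
      = indicator C x * ((p - of_bool (2 * \<eta> x - 1 < 0)) * (2 * \<eta> x - 1))"
      unfolding sgn by (cases "x \<in> C"; cases "\<eta> x < 1 / 2") (simp_all add: algebra_simps)
  qed
  finally have "\<bar>(measure P (C \<times> {1}) * p + measure P (C \<times> {0}) * (1 - p))
      - (measure P ((C \<inter> ?L) \<times> {1}) + measure P ((C \<inter> ?H) \<times> {0}))\<bar>
    = \<bar>\<integral>x. indicator C x * ((p - of_bool (2 * \<eta> x - 1 < 0)) * (2 * \<eta> x - 1)) \<partial>\<mu>\<bar>"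
    by (rule arg_cong)
  also have "\<dots> \<le> (\<integral>x. \<bar>indicator C x * ((p - of_bool (2 * \<eta> x - 1 < 0)) * (2 * \<eta> x - 1))\<bar> \<partial>\<mu>)"
    by (rule integral_abs_bound)
  also have "\<dots> \<le> (\<integral>x. indicator C x * q + 2 * (indicator C x * u x) \<partial>\<mu>)"
  proof (rule integral_mono')
    show "integrable \<mu> (\<lambda>x. indicator C x * q + 2 * (indicator C x * u x))"
      by (intro Bochner_Integration.integrable_add integrable_mult_right intq intu)
    show "\<bar>indicator C x * ((p - of_bool (2 * \<eta> x - 1 < 0)) * (2 * \<eta> x - 1))\<bar>
        \<le> indicator C x * q + 2 * (indicator C x * u x)" for x
    proof (cases "x \<in> C")
      case True
      show ?thesis
        unfolding indicator_simps(1)[OF True] mult_1 q_def u_def by (rule plug_in_error_le[OF p])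
    qed simp
    show "0 \<le> indicator C x * q + 2 * (indicator C x * u x)" for x
      by (simp add: q_def u_def)
  qed
  also have "\<dots> = q * measure \<mu> C + 2 * (\<integral>x. indicator C x * u x \<partial>\<mu>)"
    using Bochner_Integration.integral_add[OF intq integrable_mult_right[OF intu]] by (simp add: \<mu>_def)
  finally show ?thesis unfolding q_def u_def .
qed

text \<open>
  The three terms are the mass of the cells outside \<open>G\<close>, the statistical error (\<open>s\<close> bounds the standard deviation of
  \<open>box_stat\<close>), and the geometric error.  On a single cell the classifier is a function of one variable \<open>box_stat\<close>
  independent of the test pair, so the conditional probability of answering \<open>0\<close> is constant there.
\<close>

lemma excess_risk_bound:
  fixes P :: "((real ^ 'd::finite) \<times> nat) measure" and G :: "(int ^ 'd) set"
  assumes P: "labelled_distribution P" and eta: "regression_function P \<eta>"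
    and model: "privacy_model P n \<alpha> M S \<epsilon>" and n: "n > 0" and \<alpha>: "\<alpha> > 0" and h: "h > 0"
    and G: "finite G" and \<kappa>: "\<kappa> > 0" "\<And>j. j \<in> G \<Longrightarrow> \<kappa> \<le> measure (distr P borel fst) (grid_box h j)"
  defines "\<mu> \<equiv> distr P borel fst" and "f \<equiv> (\<lambda>x. 2 * \<eta> x - 1)"
    and "s \<equiv> sqrt (2 * (1 + 8 * 4 ^ CARD('d) / \<alpha>\<^sup>2) / real n)"
  shows "\<bar>excess_risk M (S 0) \<eta> (\<lambda>\<omega>. private_classifier n h (privatised n h S \<epsilon> \<omega>))\<bar>
    \<le> measure \<mu> {x. nearest_index h x \<notin> G} + 2 * s / \<kappa>
      + 2 * (\<Sum>j\<in>G. \<integral>x. indicator (grid_cell h j) x * \<bar>f x - box_average \<mu> f h j\<bar> \<partial>\<mu>)"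
proof -
  interpret prob_space M by (rule privacy_modelD(1)[OF model])
  interpret P: prob_space P by (rule labelled_distributionD(1)[OF P])
  have fst: "fst \<in> P \<rightarrow>\<^sub>M borel" by (rule labelled_distribution_coordinates(1)[OF P])
  interpret \<mu>: prob_space \<mu> unfolding \<mu>_def by (rule P.prob_space_distr[OF fst])
  have sets_mu: "sets \<mu> = sets borel" by (simp add: \<mu>_def)
  have \<eta>[measurable]: "\<eta> \<in> borel_measurable borel" using eta by (simp add: regression_function_def)
  have S0: "S 0 \<in> M \<rightarrow>\<^sub>M P" and S0_distr: "distr M P (S 0) = P"
    using privacy_modelD(2,3)[OF model, of 0] by auto
  have rect: "B \<times> {y} \<in> sets P" if "B \<in> sets borel" "y \<in> {0, 1}" for B y
    unfolding labelled_distributionD(2)[OF P] using that by (intro pair_measureI) auto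
  have prob_S0: "prob {\<omega> \<in> space M. S 0 \<omega> \<in> A} = measure P A" if "A \<in> sets P" for A
    using measure_distr[OF S0 that] by (simp add: S0_distr vimage_def Int_def conj_commute)
  have ev_S0: "{\<omega> \<in> space M. S 0 \<omega> \<in> A} \<in> events" if "A \<in> sets P" for A
    using measurable_sets[OF S0 that] by (simp add: vimage_def Int_def conj_commute)
  have S0_label: "snd (S 0 \<omega>) = 0 \<or> snd (S 0 \<omega>) = 1" if "\<omega> \<in> space M" for \<omega>
    using measurable_space[OF S0 that] unfolding labelled_distributionD(3)[OF P] by auto
  define T where "T j = box_stat n h S \<epsilon> j" for j
  define p where "p j = prob {\<omega> \<in> space M. T j \<omega> < 0}" for j
  define J where "J \<omega> = nearest_index h (fst (S 0 \<omega>))" for \<omega>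
  let ?C = "grid_cell h" and ?L = "{x. \<eta> x < 1 / 2}" and ?H = "{x. \<eta> x \<ge> 1 / 2}"
  have cell: "?C j \<in> sets borel" for j by (rule grid_cell_measurable[OF h])
  have L: "?L \<in> sets borel" and H: "?H \<in> sets borel" by measurable
  have J: "J \<in> M \<rightarrow>\<^sub>M count_space UNIV"
    unfolding J_def by (rule measurable_compose[OF measurable_compose[OF S0 fst] nearest_index_measurable[OF h]])
  have T_int: "integrable M (T j)" for j
    unfolding T_def by (rule box_stat_concentration(1)[OF P eta model n \<alpha> sets.empty_sets sets.empty_sets])
  note [measurable] = borel_measurable_integrable[OF T_int]
  have T_indep: "prob {\<omega> \<in> space M. S 0 \<omega> \<in> A \<and> T j \<omega> \<in> U} = measure P A * prob {\<omega> \<in> space M. T j \<omega> \<in> U}"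
    if "A \<in> sets P" "U \<in> sets borel" for A U j
    unfolding T_def by (rule box_stat_concentration(2)[OF P eta model n \<alpha> that])
  have T_conc: "expectation (\<lambda>\<omega>. \<bar>T j \<omega> - (\<integral>x. indicator (grid_box h j) x * f x \<partial>\<mu>) / 2\<bar>) \<le> s" for j
    unfolding T_def f_def \<mu>_def s_def
    by (rule box_stat_concentration(3)[OF P eta model n \<alpha> sets.empty_sets sets.empty_sets])
  define D where "D = {\<omega> \<in> space M. private_classifier n h (privatised n h S \<epsilon> \<omega>) (fst (S 0 \<omega>)) \<noteq> snd (S 0 \<omega>)}"
  define E where "E = {\<omega> \<in> space M. bayes_classifier \<eta> (fst (S 0 \<omega>)) \<noteq> snd (S 0 \<omega>)}"
  have S0_cell: "S 0 \<omega> \<in> ?C j \<times> {y} \<longleftrightarrow> J \<omega> = j \<and> snd (S 0 \<omega>) = y" for \<omega> j y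
    by (simp add: mem_Times_iff grid_cell_def J_def)
  have D_sub: "D \<subseteq> space M" by (auto simp: D_def)
  have D_iff: "\<omega> \<in> D \<longleftrightarrow> (T (J \<omega>) \<omega> < 0) = (snd (S 0 \<omega>) = 1)" if "\<omega> \<in> space M" for \<omega>
  proof -
    have "private_classifier n h (privatised n h S \<epsilon> \<omega>) (fst (S 0 \<omega>)) = of_bool (\<not> T (J \<omega>) \<omega> < 0)"
      by (simp only: private_classifier_def test_stat_eq_box_stat T_def J_def not_less)
    then show ?thesis
      using S0_label[OF that] that by (cases "T (J \<omega>) \<omega> < 0") (auto simp: D_def)
  qed
  have D_cell: "{\<omega> \<in> D. J \<omega> = j} = {\<omega> \<in> space M. S 0 \<omega> \<in> ?C j \<times> {1} \<and> T j \<omega> \<in> {..<0}}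
      \<union> {\<omega> \<in> space M. S 0 \<omega> \<in> ?C j \<times> {0} \<and> T j \<omega> \<in> {0..}}" for j
  proof (intro set_eqI iffI)
    fix \<omega> assume "\<omega> \<in> {\<omega> \<in> D. J \<omega> = j}"
    then have \<omega>: "\<omega> \<in> space M" "J \<omega> = j" "(T j \<omega> < 0) = (snd (S 0 \<omega>) = 1)"
      using D_iff D_sub by auto
    then show "\<omega> \<in> {\<omega> \<in> space M. S 0 \<omega> \<in> ?C j \<times> {1} \<and> T j \<omega> \<in> {..<0}}
      \<union> {\<omega> \<in> space M. S 0 \<omega> \<in> ?C j \<times> {0} \<and> T j \<omega> \<in> {0..}}"
      using S0_label[OF \<omega>(1)] unfolding S0_cell by (cases "T j \<omega> < 0") auto
  next
    fix \<omega> assume "\<omega> \<in> {\<omega> \<in> space M. S 0 \<omega> \<in> ?C j \<times> {1} \<and> T j \<omega> \<in> {..<0}}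
      \<union> {\<omega> \<in> space M. S 0 \<omega> \<in> ?C j \<times> {0} \<and> T j \<omega> \<in> {0..}}"
    then have "\<omega> \<in> space M" "J \<omega> = j" "(T j \<omega> < 0) = (snd (S 0 \<omega>) = 1)"
      unfolding S0_cell by auto
    then show "\<omega> \<in> {\<omega> \<in> D. J \<omega> = j}" using D_iff by simp
  qed
  have ev_ST: "{\<omega> \<in> space M. S 0 \<omega> \<in> A \<and> T j \<omega> \<in> U} \<in> events" if "A \<in> sets P" "U \<in> sets borel" for A U j
  proof -
    have "{\<omega> \<in> space M. T j \<omega> \<in> U} \<in> events"
      using measurable_sets[OF borel_measurable_integrable[OF T_int] that(2)]
      by (simp add: vimage_def Int_def conj_commute)
    then have "{\<omega> \<in> space M. S 0 \<omega> \<in> A} \<inter> {\<omega> \<in> space M. T j \<omega> \<in> U} \<in> events"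
      using ev_S0[OF that(1)] by (rule sets.Int[rotated])
    then show ?thesis by (simp add: Int_def conj_ac)
  qed
  have D_cell_ev: "{\<omega> \<in> D. J \<omega> = j} \<in> events" for j
    unfolding D_cell by (intro sets.Un ev_ST rect cell) auto
  have D_ev: "D \<in> events"
  proof -
    have "D = (\<Union>j. {\<omega> \<in> D. J \<omega> = j})" by auto
    also have "\<dots> \<in> events" by (intro sets.countable_UN'' D_cell_ev countableI_type)
    finally show ?thesis .
  qed
  have D_prob: "prob {\<omega> \<in> D. J \<omega> = j} = measure P (?C j \<times> {1}) * p j + measure P (?C j \<times> {0}) * (1 - p j)" for j
  proof -
    have "prob {\<omega> \<in> D. J \<omega> = j} = prob {\<omega> \<in> space M. S 0 \<omega> \<in> ?C j \<times> {1} \<and> T j \<omega> \<in> {..<0}}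
        + prob {\<omega> \<in> space M. S 0 \<omega> \<in> ?C j \<times> {0} \<and> T j \<omega> \<in> {0..}}"
      unfolding D_cell by (intro finite_measure_Union ev_ST rect cell) auto
    also have "prob {\<omega> \<in> space M. S 0 \<omega> \<in> ?C j \<times> {1} \<and> T j \<omega> \<in> {..<0}}
        = measure P (?C j \<times> {1}) * prob {\<omega> \<in> space M. T j \<omega> \<in> {..<0}}"
      by (intro T_indep rect cell) auto
    also have "prob {\<omega> \<in> space M. S 0 \<omega> \<in> ?C j \<times> {0} \<and> T j \<omega> \<in> {0..}}
        = measure P (?C j \<times> {0}) * prob {\<omega> \<in> space M. T j \<omega> \<in> {0..}}"
      by (intro T_indep rect cell) auto
    also have "prob {\<omega> \<in> space M. T j \<omega> \<in> {0..}} = 1 - p j"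
      using prob_neg[of "\<lambda>\<omega>. T j \<omega> < 0"] by (simp add: p_def not_less)
    finally show ?thesis by (simp add: p_def)
  qed
  have E_eq: "E = {\<omega> \<in> space M. S 0 \<omega> \<in> ?L \<times> {1} \<union> ?H \<times> {0}}"
    unfolding E_def
  proof (intro Collect_cong conj_cong refl)
    fix \<omega> assume "\<omega> \<in> space M"
    then show "(bayes_classifier \<eta> (fst (S 0 \<omega>)) \<noteq> snd (S 0 \<omega>)) = (S 0 \<omega> \<in> ?L \<times> {1} \<union> ?H \<times> {0})"
      using S0_label[of \<omega>]
      by (cases "\<eta> (fst (S 0 \<omega>)) < 1 / 2") (auto simp: bayes_classifier_def mem_Times_iff)
  qed
  have E_ev: "E \<in> events" unfolding E_eq by (intro ev_S0 sets.Un rect L H) auto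
  have E_prob: "prob {\<omega> \<in> E. J \<omega> = j} = measure P ((?C j \<inter> ?L) \<times> {1}) + measure P ((?C j \<inter> ?H) \<times> {0})" for j
  proof -
    have sP: "(?C j \<inter> ?L) \<times> {1} \<in> sets P" "(?C j \<inter> ?H) \<times> {0} \<in> sets P"
      by (intro rect sets.Int cell L H; simp)+
    have "{\<omega> \<in> E. J \<omega> = j} = {\<omega> \<in> space M. S 0 \<omega> \<in> (?C j \<inter> ?L) \<times> {1} \<union> (?C j \<inter> ?H) \<times> {0}}"
      by (auto simp: E_eq J_def grid_cell_def mem_Times_iff)
    then have "prob {\<omega> \<in> E. J \<omega> = j} = measure P ((?C j \<inter> ?L) \<times> {1} \<union> (?C j \<inter> ?H) \<times> {0})"
      using prob_S0[OF sets.Un[OF sP]] by simp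
    also have "\<dots> = measure P ((?C j \<inter> ?L) \<times> {1}) + measure P ((?C j \<inter> ?H) \<times> {0})"
      by (rule P.finite_measure_Union[OF sP]) auto
    finally show ?thesis .
  qed
  define a where "a j = box_average \<mu> f h j" for j
  define r where "r j = (\<integral>x. indicator (?C j) x * \<bar>f x - a j\<bar> \<partial>\<mu>)" for j
  have sign: "\<bar>p j - of_bool (a j < 0)\<bar> * \<bar>a j\<bar> \<le> 2 * s / \<kappa>" if j: "j \<in> G" for j
  proof -
    let ?m = "measure \<mu> (grid_box h j)" and ?I = "\<integral>x. indicator (grid_box h j) x * f x \<partial>\<mu>"
    have m: "\<kappa> \<le> ?m" "0 < ?m" using \<kappa> j by (auto simp: \<mu>_def intro: less_le_trans)
    have aI: "?I / 2 = a j * ?m / 2" using m by (simp add: a_def box_average_def)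
    have neg: "?I / 2 < 0 \<longleftrightarrow> a j < 0" using m(2) unfolding aI by (simp add: mult_less_0_iff)
    have "\<bar>p j - of_bool (a j < 0)\<bar> * \<bar>?I / 2\<bar> \<le> s"
      using order_trans[OF wrong_sign_probability[OF T_int[of j]] T_conc[of j]] unfolding neg p_def .
    then have "\<bar>p j - of_bool (a j < 0)\<bar> * \<bar>a j\<bar> * ?m \<le> 2 * s"
      using m(2) unfolding aI by (simp add: abs_mult)
    moreover have "\<bar>p j - of_bool (a j < 0)\<bar> * \<bar>a j\<bar> * \<kappa> \<le> \<bar>p j - of_bool (a j < 0)\<bar> * \<bar>a j\<bar> * ?m"
      by (intro mult_left_mono m) simp
    ultimately have "\<bar>p j - of_bool (a j < 0)\<bar> * \<bar>a j\<bar> * \<kappa> \<le> 2 * s" by linarith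
    then show ?thesis using \<kappa>(1) by (simp add: pos_le_divide_eq)
  qed
  have s: "s \<ge> 0" by (simp add: s_def)
  have cell_sum: "(\<Sum>j\<in>G. measure \<mu> (?C j)) \<le> 1"
  proof -
    have "(\<Sum>j\<in>G. measure \<mu> (?C j)) = measure \<mu> (\<Union>j\<in>G. ?C j)"
      using G cell by (intro \<mu>.finite_measure_finite_Union[symmetric])
        (auto simp: disjoint_family_on_def grid_cell_def sets_mu)
    then show ?thesis by simp
  qed
  have "\<bar>prob D - prob E\<bar> \<le> (\<Sum>j\<in>G. \<bar>prob {\<omega> \<in> D. J \<omega> = j} - prob {\<omega> \<in> E. J \<omega> = j}\<bar>)
      + prob {\<omega> \<in> space M. J \<omega> \<notin> G}"
    by (rule prob_difference_by_cells[OF D_ev E_ev J G])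
  also have "prob {\<omega> \<in> space M. J \<omega> \<notin> G} = measure \<mu> {x. nearest_index h x \<notin> G}"
  proof -
    have B: "{x. nearest_index h x \<notin> G} \<in> sets borel"
      using measurable_sets[OF nearest_index_measurable[OF h], of "- G"] by (simp add: vimage_def)
    have "measure \<mu> {x. nearest_index h x \<notin> G} = measure (distr (distr M P (S 0)) borel fst) {x. nearest_index h x \<notin> G}"
      unfolding S0_distr \<mu>_def ..
    also have "\<dots> = measure (distr M borel (fst \<circ> S 0)) {x. nearest_index h x \<notin> G}"
      unfolding distr_distr[OF fst S0] ..
    also have "\<dots> = prob ((fst \<circ> S 0) -` {x. nearest_index h x \<notin> G} \<inter> space M)"
      by (rule measure_distr[OF measurable_comp[OF S0 fst] B])
    also have "(fst \<circ> S 0) -` {x. nearest_index h x \<notin> G} \<inter> space M = {\<omega> \<in> space M. J \<omega> \<notin> G}"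
      by (auto simp: J_def)
    finally show ?thesis ..
  qed
  also have "(\<Sum>j\<in>G. \<bar>prob {\<omega> \<in> D. J \<omega> = j} - prob {\<omega> \<in> E. J \<omega> = j}\<bar>)
      \<le> (\<Sum>j\<in>G. 2 * s / \<kappa> * measure \<mu> (?C j) + 2 * r j)"
  proof (rule sum_mono)
    fix j assume j: "j \<in> G"
    have "\<bar>prob {\<omega> \<in> D. J \<omega> = j} - prob {\<omega> \<in> E. J \<omega> = j}\<bar>
        \<le> \<bar>p j - of_bool (a j < 0)\<bar> * \<bar>a j\<bar> * measure \<mu> (?C j) + 2 * r j"
      unfolding D_prob E_prob r_def f_def \<mu>_def
      by (rule cell_risk_difference[OF P eta cell]) (auto simp: p_def)
    also have "\<dots> \<le> 2 * s / \<kappa> * measure \<mu> (?C j) + 2 * r j"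
      by (intro add_right_mono mult_right_mono sign[OF j]) simp
    finally show "\<bar>prob {\<omega> \<in> D. J \<omega> = j} - prob {\<omega> \<in> E. J \<omega> = j}\<bar> \<le> 2 * s / \<kappa> * measure \<mu> (?C j) + 2 * r j" .
  qed
  also have "\<dots> = 2 * s / \<kappa> * (\<Sum>j\<in>G. measure \<mu> (?C j)) + 2 * (\<Sum>j\<in>G. r j)"
    by (simp only: sum.distrib sum_distrib_left)
  also have "2 * s / \<kappa> * (\<Sum>j\<in>G. measure \<mu> (?C j)) \<le> 2 * s / \<kappa> * 1"
    using s \<kappa>(1) by (intro mult_left_mono cell_sum) simp
  finally have "\<bar>prob D - prob E\<bar> \<le> measure \<mu> {x. nearest_index h x \<notin> G} + 2 * s / \<kappa> + 2 * (\<Sum>j\<in>G. r j)"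
    by linarith
  then show ?thesis
    unfolding excess_risk_def risk_def D_def E_def r_def a_def .
qed

theorem theorem2p2:
  fixes P :: "((real ^ 'd::finite) \<times> nat) measure"
    and \<eta> :: "real ^ 'd \<Rightarrow> real"
    and h \<alpha> :: "nat \<Rightarrow> real"
    and M :: "nat \<Rightarrow> 'w measure"
    and S :: "nat \<Rightarrow> nat \<Rightarrow> 'w \<Rightarrow> (real ^ 'd) \<times> nat"
    and \<epsilon> :: "nat \<Rightarrow> nat \<Rightarrow> int ^ 'd \<Rightarrow> 'w \<Rightarrow> real"
  assumes P: "labelled_distribution P"
    and eta: "regression_function P \<eta>"
    and h_pos: "\<And>n. h n > 0"
    and alpha_pos: "\<And>n. \<alpha> n > 0"
    and alpha_bdd: "bdd_above (range \<alpha>)"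
    and model: "\<And>n. privacy_model P n (\<alpha> n) (M n) (S n) (\<epsilon> n)"
    and h_lim: "h \<longlonglongrightarrow> 0"
    and rate: "filterlim (\<lambda>n. real n * (\<alpha> n)\<^sup>2 * h n ^ (2 * CARD('d))) at_top sequentially"
  shows "(\<lambda>n. excess_risk (M n) (S n 0) \<eta>
            (\<lambda>\<omega>. private_classifier n (h n) (privatised n (h n) (S n) (\<epsilon> n) \<omega>)))
         \<longlonglongrightarrow> 0"
proof (rule LIMSEQ_I)
  fix \<epsilon>' :: real assume "\<epsilon>' > 0"
  \<comment> \<open>The three terms of the bound contribute \<open>e\<close>, \<open>2 * e\<close> and \<open>2 * e\<close>.\<close>
  define e where "e = \<epsilon>' / 6"
  have e: "e > 0" using \<open>\<epsilon>' > 0\<close> by (simp add: e_def)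
  define \<mu> where "\<mu> = distr P borel fst"
  define f where "f = (\<lambda>x. 2 * \<eta> x - 1)"
  interpret P: prob_space P by (rule labelled_distributionD(1)[OF P])
  have fst: "fst \<in> P \<rightarrow>\<^sub>M borel" by (rule labelled_distribution_coordinates(1)[OF P])
  interpret \<mu>: prob_space \<mu> unfolding \<mu>_def by (rule P.prob_space_distr[OF fst])
  have sets_mu: "sets \<mu> = sets borel" by (simp add: \<mu>_def)
  have fin: "finite_measure \<mu>" by (rule \<mu>.finite_measure_axioms)
  have "integrable \<mu> \<eta>" unfolding \<mu>_def by (rule regression_function_integral(1)[OF P eta])
  then have f: "integrable \<mu> f"
    unfolding f_def by (intro Bochner_Integration.integrable_diff integrable_mult_right \<mu>.integrable_const)
  obtain \<delta> where \<delta>: "\<delta> > 0" "\<And>h J. 0 < h \<Longrightarrow> h < \<delta> \<Longrightarrow> finite J \<Longrightarrow> (\<forall>j\<in>J. measure \<mu> (grid_box h j) > 0) \<Longrightarrow>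
      (\<Sum>j\<in>J. \<integral>x. indicator (grid_cell h j) x * \<bar>f x - box_average \<mu> f h j\<bar> \<partial>\<mu>) \<le> e"
    using box_average_converges_L1[OF fin sets_mu f e] by blast
  obtain t where t: "t > 0" "\<And>h. 0 < h \<Longrightarrow> h \<le> 1 \<Longrightarrow> \<exists>G. finite G \<and>
      (\<forall>j\<in>G. t * h ^ CARD('d) \<le> measure \<mu> (grid_box h j)) \<and> measure \<mu> {x. nearest_index h x \<notin> G} \<le> e"
    using light_boxes_negligible[OF fin sets_mu e] by blast
  obtain A where A: "\<And>n. \<alpha> n \<le> A" using alpha_bdd by (auto simp: bdd_above_def)
  \<comment> \<open>Once the rate exceeds \<open>L\<close>, the standard deviation is at most \<open>e\<close> times the lower bound on the box masses.\<close>
  define L where "L = 2 * (A\<^sup>2 + 8 * 4 ^ CARD('d)) / (e * t)\<^sup>2"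
  have et: "(e * t)\<^sup>2 > 0" using e t(1) by simp
  have L_pos: "L > 0"
  proof -
    have "A\<^sup>2 + 8 * 4 ^ CARD('d) > 0" by (intro add_nonneg_pos) auto
    then show ?thesis using et by (simp add: L_def)
  qed
  have "\<forall>\<^sub>F n in sequentially. h n < min \<delta> 1"
    using order_tendstoD(2)[OF h_lim, of "min \<delta> 1"] \<delta>(1) by simp
  moreover have "\<forall>\<^sub>F n in sequentially. L \<le> real n * (\<alpha> n)\<^sup>2 * h n ^ (2 * CARD('d))"
    using rate by (simp add: filterlim_at_top)
  ultimately have "\<forall>\<^sub>F n in sequentially. \<bar>excess_risk (M n) (S n 0) \<eta>
      (\<lambda>\<omega>. private_classifier n (h n) (privatised n (h n) (S n) (\<epsilon> n) \<omega>))\<bar> < \<epsilon>'"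
  proof eventually_elim
    case (elim n)
    let ?s = "sqrt (2 * (1 + 8 * 4 ^ CARD('d) / (\<alpha> n)\<^sup>2) / real n)" and ?\<kappa> = "t * h n ^ CARD('d)"
    have hn: "h n < \<delta>" "h n \<le> 1" using elim(1) by auto
    have n: "n > 0"
    proof (rule ccontr)
      assume "\<not> n > 0"
      then have "L \<le> 0" using elim(2) by simp
      then show False using L_pos by simp
    qed
    have \<kappa>: "?\<kappa> > 0" using t(1) h_pos by simp
    obtain G where G: "finite G" "\<And>j. j \<in> G \<Longrightarrow> ?\<kappa> \<le> measure \<mu> (grid_box (h n) j)"
      "measure \<mu> {x. nearest_index (h n) x \<notin> G} \<le> e"
      using t(2)[OF h_pos hn(2)] by blast
    have pos: "\<forall>j\<in>G. measure \<mu> (grid_box (h n) j) > 0" using G(2) \<kappa> by (blast intro: less_le_trans)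
    have "?s \<le> e * ?\<kappa>"
    proof (rule real_le_lsqrt)
      show "0 \<le> e * ?\<kappa>" using e \<kappa> by simp
      have "(\<alpha> n)\<^sup>2 \<le> A\<^sup>2" using A[of n] alpha_pos[of n] by (intro power_mono) auto
      then have "2 * ((\<alpha> n)\<^sup>2 + 8 * 4 ^ CARD('d)) \<le> 2 * (A\<^sup>2 + 8 * 4 ^ CARD('d))" by simp
      also have "\<dots> = L * (e * t)\<^sup>2" using et by (simp add: L_def)
      also have "\<dots> \<le> real n * (\<alpha> n)\<^sup>2 * h n ^ (2 * CARD('d)) * (e * t)\<^sup>2"
        using elim(2) by (intro mult_right_mono) auto
      also have "\<dots> = (e * ?\<kappa>)\<^sup>2 * (real n * (\<alpha> n)\<^sup>2)"
        by (simp add: power_mult_distrib power_mult[symmetric] mult.commute[of 2] mult_ac)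
      finally have "2 * ((\<alpha> n)\<^sup>2 + 8 * 4 ^ CARD('d)) / (real n * (\<alpha> n)\<^sup>2) \<le> (e * ?\<kappa>)\<^sup>2"
        using n alpha_pos[of n] by (subst pos_divide_le_eq) auto
      moreover have "2 * ((\<alpha> n)\<^sup>2 + 8 * 4 ^ CARD('d)) / (real n * (\<alpha> n)\<^sup>2) = 2 * (1 + 8 * 4 ^ CARD('d) / (\<alpha> n)\<^sup>2) / real n"
        using n alpha_pos[of n] by (simp add: field_simps)
      ultimately show "2 * (1 + 8 * 4 ^ CARD('d) / (\<alpha> n)\<^sup>2) / real n \<le> (e * ?\<kappa>)\<^sup>2" by simp
    qed
    then have noise: "2 * ?s / ?\<kappa> \<le> 2 * e" using \<kappa> by (simp add: pos_divide_le_eq)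
    have "\<bar>excess_risk (M n) (S n 0) \<eta> (\<lambda>\<omega>. private_classifier n (h n) (privatised n (h n) (S n) (\<epsilon> n) \<omega>))\<bar>
        \<le> measure \<mu> {x. nearest_index (h n) x \<notin> G} + 2 * ?s / ?\<kappa>
          + 2 * (\<Sum>j\<in>G. \<integral>x. indicator (grid_cell (h n) j) x * \<bar>f x - box_average \<mu> f (h n) j\<bar> \<partial>\<mu>)"
      unfolding \<mu>_def f_def
      by (rule excess_risk_bound[OF P eta model n alpha_pos h_pos G(1) \<kappa> G(2)[unfolded \<mu>_def]])
    also have "\<dots> \<le> e + 2 * e + 2 * e"
      by (intro add_mono G(3) noise mult_left_mono \<delta>(2)[OF h_pos hn(1) G(1) pos]) simp
    also have "\<dots> < \<epsilon>'" using \<open>\<epsilon>' > 0\<close> by (simp add: e_def)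
    finally show ?case .
  qed
  then show "\<exists>no. \<forall>n\<ge>no. norm (excess_risk (M n) (S n 0) \<eta>
      (\<lambda>\<omega>. private_classifier n (h n) (privatised n (h n) (S n) (\<epsilon> n) \<omega>)) - 0) < \<epsilon>'"
    by (simp add: eventually_sequentially)
qed

end
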